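(* Let $\sigma$ be a $\lambda$-uniform substitution on $\{a,b\}$ with $\delta_1(\sigma)=0$ and $\delta_2:=\delta_2(\sigma)\ne0$, admitting a fixed point $w=w_0w_1\cdots\in\{a,b\}^{\mathbb{N}}$, and let $\varphi:\{a,b\}\to\mathbb{R}$ be a non-constant function. Let $f_w^{(i)}:[0,\infty[\to\mathbb{R}$ and $f_a^{(i)},f_b^{(i)}:[0,\lambda]\to\mathbb{R}$ ($i\ge1$) be the associated renormalized step functions and $(c_i)$ the associated constants (defined in the context). Then the sequences $f_w^{(i)}$, $f_a^{(i)}$, $f_b^{(i)}$ converge uniformly, as $i\to\infty$, to continuous functions $f_w$, $f_a$, $f_b$ on $[0,\infty[$, $[0,\lambda]$ and $[0,\lambda]$ respectively. Moreover: (1) $f_a$ and $f_b$ are not identically zero; (2) $f_a(0)=f_b(0)=\lim_{i\to\infty}\dfrac{-c_i}{\delta_2^{\,i-1}\lambda^{(i-1)(i-2)/2}}$; (3) for $x\in[0,\lambda]$ and every integer $n\ge0$, $f_w(x+\lambda n)=f_{w_n}(x)$; (4) $f_w$ satisfies $\displaystyle\int_0^{\lambda x}f_w(t)\,dt=\delta_2\,\big(f_w(x)-f_w(0)\big)$ for all $x\ge0$.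
   Context: A substitution $\sigma$ is a morphism of $\{a,b\}^*$, acting on infinite words letter by letter; it is $\lambda$-uniform if $|\sigma(a)|=|\sigma(b)|=\lambda$; a fixed point is $w$ with $\sigma(w)=w$. Iterated Birkhoff sums of a word $u$: $S^{(1)}_n(\varphi,u)=\sum_{k=0}^{n-1}\varphi(u_k)$, $S^{(\ell+1)}_n(\varphi,u)=\sum_{k=0}^{n-1}S^{(\ell)}_k(\varphi,u)$, $S^{(\ell)}_0=0$. For $i\ge1$, $\delta_i(\sigma)=\dfrac{S^{(i)}_\lambda(\varphi,\sigma(a))-S^{(i)}_\lambda(\varphi,\sigma(b))}{\varphi(a)-\varphi(b)}$, independent of $\varphi$ with $\varphi(a)\neq\varphi(b)$. The language of $\sigma$ is the set of factors of the words $\sigma^n(\alpha)$ ($n\ge0$, $\alpha\in\{a,b\}$). $K_\sigma\subset\{a,b\}^{\mathbb{N}}$ is the compact set of infinite words all of whose factors are in the language, $T$ is the shift $(Tu)_i=u_{i+1}$ on $K_\sigma$, and $\mu$ is the unique $T$-invariant probability measure on $K_\sigma$. The function $\varphi$ is viewed on $K_\sigma$ via $\varphi(u)=\varphi(u_0)$. There is a unique constant $\psi_0$ and a unique sequence of continuous functions $\psi_i:K_\sigma\to\mathbb{R}$ ($i\ge1$) with $$\psi_0=-\int\varphi\,d\mu,\qquad \varphi+\psi_0=\psi_1\circ T-\psi_1,\qquad \psi_n=\psi_{n+1}\circ T-\psi_{n+1}\quad(n\ge1).$$ The constants are $c_i=-\psi_i(w)$. With $[\alpha]=\{u\in K_\sigma: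 u_0=\alpha\}$, the function $\psi_i$ is constant on each $T^m\sigma^i([\alpha])$, $0\le m<\lambda^i$, $\alpha\in\{a,b\}$; its value there is denoted $\psi(i,m,\alpha)$, and moreover $\psi_i(T^{\lambda^i}u)=\psi_i(u)$ for $u\in\sigma^i([\alpha])$, so one sets $\psi(i,\lambda^i,\alpha)=\psi(i,0,\alpha)$. For $i\ge1$, $$f_w^{(i)}(x)=\frac{\psi_i(T^m w)}{\delta_2^{\,i-1}\lambda^{(i-1)(i-2)/2}}\ \ (x\ge0),\qquad f_\alpha^{(i)}(x)=\frac{\psi(i,m,\alpha)}{\delta_2^{\,i-1}\lambda^{(i-1)(i-2)/2}}\ \ (x\in[0,\lambda],\ \alpha\in\{a,b\}),$$ where $m=\lfloor\lambda^{i-1}x\rfloor$. *)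

theory Defs
  imports "HOL-Probability.Probability" "HOL-Library.Sublist"
begin

datatype letter = La | Lb

text \<open>The two-letter alphabet is discrete; infinite words \<open>nat \<Rightarrow> letter\<close> then
  carry the product topology of the library.\<close>

instantiation letter :: discrete_topology
begin

definition open_letter :: "letter set \<Rightarrow> bool" where
  "open_letter U \<longleftrightarrow> True"

instance
  by standard (simp_all add: open_letter_def)

end

text \<open>A substitution is given by the images of the letters.\<close>

definition subst_list :: "(letter \<Rightarrow> letter list) \<Rightarrow> letter list \<Rightarrow> letter list" where
  "subst_list \<sigma> v = concat (map \<sigma> v)"

text \<open>Letter \<open>n\<close> of \<open>\<sigma>(u)\<close> is read off \<open>\<sigma>(u\<^sub>0 \<dots> u\<^sub>n)\<close>, which is a prefix of \<open>\<sigma>(u)\<close> of length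
  greater than \<open>n\<close> as soon as neither letter has an empty image. Erasing substitutions
  are not intended here.\<close>

definition subst_word :: "(letter \<Rightarrow> letter list) \<Rightarrow> (nat \<Rightarrow> letter) \<Rightarrow> nat \<Rightarrow> letter" where
  "subst_word \<sigma> u n = subst_list \<sigma> (map u [0..<Suc n]) ! n"

definition uniform_subst :: "nat \<Rightarrow> (letter \<Rightarrow> letter list) \<Rightarrow> bool" where
  "uniform_subst lam \<sigma> \<longleftrightarrow> length (\<sigma> La) = lam \<and> length (\<sigma> Lb) = lam"

text \<open>\<open>birkhoff \<phi> u l n\<close> is \<open>S\<^sub>n\<^sup>(\<^sup>l\<^sup>)(\<phi>, u)\<close>. The level \<open>l = 0\<close>, with value \<open>\<phi>(u\<^sub>n)\<close>, only serves to
  start the recursion. Only the letters \<open>u\<^sub>k\<close> with \<open>k < n\<close> matter for \<open>l \<ge> 1\<close>, so finite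
  words can be passed as \<open>(!) v\<close>.\<close>

primrec birkhoff :: "(letter \<Rightarrow> real) \<Rightarrow> (nat \<Rightarrow> letter) \<Rightarrow> nat \<Rightarrow> nat \<Rightarrow> real" where
  "birkhoff \<phi> u 0 n = \<phi> (u n)"
| "birkhoff \<phi> u (Suc l) n = (\<Sum>k<n. birkhoff \<phi> u l k)"

text \<open>The value does not depend on \<open>\<phi>\<close>, provided \<open>\<phi> La \<noteq> \<phi> Lb\<close>.\<close>

definition delta :: "(letter \<Rightarrow> letter list) \<Rightarrow> (letter \<Rightarrow> real) \<Rightarrow> nat \<Rightarrow> real" where
  "delta \<sigma> \<phi> i =
     (birkhoff \<phi> ((!) (\<sigma> La)) i (length (\<sigma> La)) - birkhoff \<phi> ((!) (\<sigma> Lb)) i (length (\<sigma> Lb)))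
       / (\<phi> La - \<phi> Lb)"

definition language :: "(letter \<Rightarrow> letter list) \<Rightarrow> letter list set" where
  "language \<sigma> = {v. \<exists>n \<alpha>. sublist v ((subst_list \<sigma> ^^ n) [\<alpha>])}"

definition subshift :: "(letter \<Rightarrow> letter list) \<Rightarrow> (nat \<Rightarrow> letter) set" where
  "subshift \<sigma> = {u. \<forall>i j. map u [i..<j] \<in> language \<sigma>}"

definition shift :: "(nat \<Rightarrow> letter) \<Rightarrow> nat \<Rightarrow> letter" where
  "shift u i = u (Suc i)"

definition cylinder :: "(letter \<Rightarrow> letter list) \<Rightarrow> letter \<Rightarrow> (nat \<Rightarrow> letter) set" where
  "cylinder \<sigma> \<alpha> = {u \<in> subshift \<sigma>. u 0 = \<alpha>}"

definition invariant_prob :: "(letter \<Rightarrow> letter list) \<Rightarrow> (nat \<Rightarrow> letter) measure \<Rightarrow> bool" where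
  "invariant_prob \<sigma> \<mu> \<longleftrightarrow>
     prob_space \<mu> \<and> space \<mu> = subshift \<sigma> \<and> sets \<mu> = sets (restrict_space borel (subshift \<sigma>)) \<and>
     (\<forall>X\<in>sets \<mu>. emeasure \<mu> (shift -` X \<inter> space \<mu>) = emeasure \<mu> X)"

text \<open>The constant \<open>\<psi>\<^sub>0\<close> and the functions \<open>\<psi>\<^sub>i\<close>, \<open>i \<ge> 1\<close>. Only the values of \<open>\<psi> i\<close> on the
  subshift are constrained, and \<open>\<psi> 0\<close> is not used.\<close>

definition psi_sequence ::
  "(letter \<Rightarrow> letter list) \<Rightarrow> (letter \<Rightarrow> real) \<Rightarrow> (nat \<Rightarrow> letter) measure \<Rightarrow>
     real \<Rightarrow> (nat \<Rightarrow> (nat \<Rightarrow> letter) \<Rightarrow> real) \<Rightarrow> bool" where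
  "psi_sequence \<sigma> \<phi> \<mu> \<psi>\<^sub>0 \<psi> \<longleftrightarrow>
     \<psi>\<^sub>0 = - (\<integral>u. \<phi> (u 0) \<partial>\<mu>) \<and>
     (\<forall>i\<ge>1. continuous_on (subshift \<sigma>) (\<psi> i)) \<and>
     (\<forall>u\<in>subshift \<sigma>. \<phi> (u 0) + \<psi>\<^sub>0 = \<psi> 1 (shift u) - \<psi> 1 u) \<and>
     (\<forall>n\<ge>1. \<forall>u\<in>subshift \<sigma>. \<psi> n u = \<psi> (Suc n) (shift u) - \<psi> (Suc n) u)"

definition const_c :: "(nat \<Rightarrow> (nat \<Rightarrow> letter) \<Rightarrow> real) \<Rightarrow> (nat \<Rightarrow> letter) \<Rightarrow> nat \<Rightarrow> real" where
  "const_c \<psi> w i = - \<psi> i w"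

text \<open>The value of \<open>\<psi>\<^sub>i\<close> on \<open>T\<^sup>m \<sigma>\<^sup>i([\<alpha>])\<close> for \<open>0 \<le> m < \<lambda>\<^sup>i\<close>, where \<open>\<psi>\<^sub>i\<close> is constant; the
  end point \<open>m = \<lambda>\<^sup>i\<close> is given the value at \<open>m = 0\<close>.\<close>

definition block_value ::
  "(letter \<Rightarrow> letter list) \<Rightarrow> nat \<Rightarrow> (nat \<Rightarrow> (nat \<Rightarrow> letter) \<Rightarrow> real) \<Rightarrow>
     nat \<Rightarrow> nat \<Rightarrow> letter \<Rightarrow> real" where
  "block_value \<sigma> lam \<psi> i m \<alpha> =
     the_elem (\<psi> i ` (shift ^^ (if m = lam ^ i then 0 else m)) ` (subst_word \<sigma> ^^ i) ` cylinder \<sigma> \<alpha>)"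

definition renorm :: "(letter \<Rightarrow> letter list) \<Rightarrow> nat \<Rightarrow> (letter \<Rightarrow> real) \<Rightarrow> nat \<Rightarrow> real" where
  "renorm \<sigma> lam \<phi> i = delta \<sigma> \<phi> 2 ^ (i - 1) * real lam ^ ((i - 1) * (i - 2) div 2)"

definition step_word ::
  "(letter \<Rightarrow> letter list) \<Rightarrow> nat \<Rightarrow> (letter \<Rightarrow> real) \<Rightarrow> (nat \<Rightarrow> (nat \<Rightarrow> letter) \<Rightarrow> real) \<Rightarrow>
     (nat \<Rightarrow> letter) \<Rightarrow> nat \<Rightarrow> real \<Rightarrow> real" where
  "step_word \<sigma> lam \<phi> \<psi> w i x =
     \<psi> i ((shift ^^ nat \<lfloor>real lam ^ (i - 1) * x\<rfloor>) w) / renorm \<sigma> lam \<phi> i"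

definition step_letter ::
  "(letter \<Rightarrow> letter list) \<Rightarrow> nat \<Rightarrow> (letter \<Rightarrow> real) \<Rightarrow> (nat \<Rightarrow> (nat \<Rightarrow> letter) \<Rightarrow> real) \<Rightarrow>
     letter \<Rightarrow> nat \<Rightarrow> real \<Rightarrow> real" where
  "step_letter \<sigma> lam \<phi> \<psi> \<alpha> i x =
     block_value \<sigma> lam \<psi> i (nat \<lfloor>real lam ^ (i - 1) * x\<rfloor>) \<alpha> / renorm \<sigma> lam \<phi> i"

end

theory Submission
  imports Defs
begin

text \<open>Write \<open>G n N\<close> for \<open>\<psi>\<^sub>n\<^sub>+\<^sub>1(T\<^sup>N w)\<close>. Along the orbit of \<open>w\<close> these sequences are successive
primitives: \<open>G 0\<close> has the increments \<open>p(w\<^sub>N)\<close> with \<open>p = \<phi> + \<psi>\<^sub>0\<close>, and \<open>G (n + 1)\<close> has the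
increments \<open>G n\<close>. All of them are bounded, as \<open>\<psi>\<^sub>n\<^sub>+\<^sub>1\<close> is continuous on a compact set. A
bounded sequence has no drift, so boundedness determines every constant of integration.

Because \<open>w = \<sigma>(w)\<close>, the increment of \<open>N \<mapsto> G n (\<lambda> N)\<close> is a sum over one image \<open>\<sigma>(w\<^sub>N)\<close>, and
its dependence on \<open>w\<^sub>N\<close> is measured by the numbers \<open>\<delta>\<^sub>i\<close>. Integrating gives the triangular
scaling relation \<open>G n (\<lambda> N) = (\<Sum>j<n. c j n * G j N) + const\<close> (\<open>G_scale\<close>), which starts one
level below \<open>n\<close> because \<open>\<delta>\<^sub>1 = 0\<close>. Its leading coefficient \<open>c (n - 1) n = \<delta>\<^sub>2 \<lambda>\<^sup>n\<^sup>-\<^sup>1\<close> is exactly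
the ratio of consecutive renormalizing factors. The remaining coefficients are
negligible, since the factors grow like \<open>\<lambda>\<close> to a quadratic power of \<open>n\<close> whereas the
coefficients grow geometrically (\<open>coef_negligible\<close>). Hence two consecutive renormalized
step functions differ uniformly by the terms of a convergent series
(\<open>growth_estimate\<close>, \<open>F_increment\<close>), and their jumps tend to zero, so that the limit is
continuous.

The other assertions have counterparts before the passage to the limit. As \<open>G (n + 1)\<close> is
a primitive of \<open>G n\<close>, the step function of one level is, on a grid, an integral of the
step function of the level before; this gives the integral equation. The scaling
relation iterated \<open>n\<close> times has only one term that is not constant, so at the integers
the limit reproduces \<open>G 0\<close> up to an additive constant (\<open>limit_at_nat\<close>); the increments
\<open>p(w\<^sub>N)\<close> of \<open>G 0\<close> do not all vanish on a block, because each image \<open>\<sigma>(\<alpha>)\<close> contains both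
letters. Finally the value of \<open>G n\<close> inside a block \<open>\<sigma>\<^sup>i(w\<^sub>k)\<close>, \<open>i > n\<close>, depends only on the
letter \<open>w\<^sub>k\<close> and the position (\<open>G_determined\<close>). By density of the orbit this makes \<open>\<psi>\<^sub>n\<^sub>+\<^sub>1\<close>
constant on the sets \<open>T\<^sup>m \<sigma>\<^sup>i([\<alpha>])\<close>, and \<open>f\<^sub>\<alpha>\<close> is a translate of the restriction of \<open>f\<^sub>w\<close> to any
interval \<open>[\<lambda> N, \<lambda> N + \<lambda>]\<close> with \<open>w\<^sub>N = \<alpha>\<close>.\<close>

section \<open>Birkhoff sums and the two letters\<close>

lemma sum_choose_lessThan: "(\<Sum>k<m. k choose t) = m choose Suc t"
  by (induction m) auto

lemma birkhoff_cong:
  assumes "\<And>k. k < n \<Longrightarrow> u k = v k"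
  shows "birkhoff p u (Suc l) n = birkhoff p v (Suc l) n"
  using assms
proof (induction l arbitrary: n)
  case (Suc l)
  then show ?case unfolding birkhoff.simps(2)[of _ _ "Suc l"] by (intro sum.cong) auto
qed simp

text \<open>This identity makes \<open>\<delta>\<^sub>i\<close> insensitive to the replacement of \<open>\<phi>\<close> by \<open>\<phi> + \<psi>\<^sub>0\<close>: in a
\<open>\<lambda>\<close>-uniform substitution both images receive the same correction.\<close>
lemma birkhoff_add_const:
  "birkhoff (\<lambda>\<alpha>. p \<alpha> + c) u l n = birkhoff p u l n + c * real (n choose l)"
proof (induction l arbitrary: n)
  case (Suc l)
  have "(\<Sum>k<n. real (k choose l)) = real (n choose Suc l)"
    by (simp flip: of_nat_sum add: sum_choose_lessThan)
  then show ?case by (simp add: Suc sum.distrib flip: sum_distrib_left)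
qed simp

lemma birkhoff_bound:
  assumes "\<And>\<alpha>. \<bar>p \<alpha>\<bar> \<le> P"
  shows "n \<le> m \<Longrightarrow> \<bar>birkhoff p u l n\<bar> \<le> P * real m ^ l"
proof (induction l arbitrary: n)
  case 0
  then show ?case using assms by simp
next
  case (Suc l)
  have P: "0 \<le> P" using assms[of La] by linarith
  have "\<bar>birkhoff p u (Suc l) n\<bar> \<le> (\<Sum>k<n. \<bar>birkhoff p u l k\<bar>)" by simp
  also have "\<dots> \<le> (\<Sum>k<n. P * real m ^ l)"
    using Suc by (intro sum_mono) auto
  also have "\<dots> = real n * (P * real m ^ l)" by simp
  also have "\<dots> \<le> real m * (P * real m ^ l)" using Suc.prems P by (intro mult_right_mono) auto
  finally show ?case by (simp add: mult_ac)
qed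

lemma delta_add_const:
  assumes "uniform_subst lam \<sigma>"
  shows "delta \<sigma> (\<lambda>\<alpha>. p \<alpha> + c) i = delta \<sigma> p i"
  using assms by (simp add: delta_def uniform_subst_def birkhoff_add_const)

text \<open>The second Birkhoff sum of a word does not see its last letter, so it is zero on words
with fewer than two letters.\<close>
lemma two_le_length:
  assumes "uniform_subst lam \<sigma>" "delta \<sigma> p 2 \<noteq> 0"
  shows "2 \<le> lam"
proof (rule ccontr)
  assume "\<not> 2 \<le> lam"
  then have "lam = 0 \<or> lam = 1" by linarith
  then have "delta \<sigma> p 2 = 0"
    using assms(1) by (auto simp: delta_def uniform_subst_def numeral_2_eq_2)
  with assms(2) show False by simp
qed

text \<open>If \<open>\<beta>\<close> is missing from \<open>\<sigma>(\<alpha>)\<close>, this word is a power of the other letter. By \<open>\<delta>\<^sub>1 = 0\<close> both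
images have the same number of occurrences of each letter, so they coincide, which
contradicts \<open>\<delta>\<^sub>2 \<noteq> 0\<close>.\<close>
lemma both_letters:
  assumes uniform: "uniform_subst lam \<sigma>" and p_ne: "p La \<noteq> p Lb"
    and delta1: "delta \<sigma> p 1 = 0" and delta2: "delta \<sigma> p 2 \<noteq> 0"
  shows "\<exists>r<lam. \<sigma> \<alpha> ! r = \<beta>"
proof (rule ccontr)
  have len [simp]: "length (\<sigma> \<alpha>) = lam" for \<alpha>
    using uniform by (cases \<alpha>) (auto simp: uniform_subst_def)
  assume none: "\<not> (\<exists>r<lam. \<sigma> \<alpha> ! r = \<beta>)"
  obtain \<gamma> where \<gamma>: "\<gamma> \<noteq> \<beta>" by (cases \<beta>) auto
  have two: "x = \<gamma>" if "x \<noteq> \<beta>" for x using that \<gamma> by (cases x; cases \<beta>; cases \<gamma>) auto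
  have p: "p \<beta> - p \<gamma> \<noteq> 0" using \<gamma> p_ne by (cases \<beta>; cases \<gamma>) auto
  have sums: "(\<Sum>r<lam. p (\<sigma> La ! r)) = (\<Sum>r<lam. p (\<sigma> Lb ! r))"
    using delta1 p_ne by (simp add: delta_def)
  have const: "\<sigma> \<alpha> ! r = \<gamma>" if "r < lam" for r using none two that by blast
  have all: "\<sigma> \<alpha>' ! r = \<gamma>" if r: "r < lam" for \<alpha>' r
  proof -
    have "(\<Sum>r<lam. p (\<sigma> \<alpha>' ! r)) = (\<Sum>r<lam. p (\<sigma> \<alpha> ! r))"
      using sums by (cases \<alpha>; cases \<alpha>') auto
    also have "\<dots> = (\<Sum>r<lam. p \<gamma>)" using const by simp
    finally have "0 = (\<Sum>r<lam. p (\<sigma> \<alpha>' ! r) - p \<gamma>)" by (simp add: sum_subtractf)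
    also have "\<dots> = (\<Sum>r<lam. (p \<beta> - p \<gamma>) * of_bool (\<sigma> \<alpha>' ! r = \<beta>))"
      using two by (intro sum.cong) auto
    finally have "(\<Sum>r<lam. of_bool (\<sigma> \<alpha>' ! r = \<beta>) :: real) = 0"
      using p by (simp flip: sum_distrib_left)
    then have "of_bool (\<sigma> \<alpha>' ! r = \<beta>) = (0 :: real)"
      using r by (subst (asm) sum_nonneg_eq_0_iff) auto
    then show ?thesis using two by auto
  qed
  have "\<sigma> La = \<sigma> Lb" by (rule nth_equalityI) (auto simp: all)
  then show False using delta2 by (simp add: delta_def)
qed

section \<open>Bounded iterated primitives and the scaling relation\<close>

text \<open>This is how boundedness of the primitives determines their constants of integration. With
\<open>e = 0\<close> it forces a constant increment to vanish; with \<open>e > 0\<close> it estimates the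
constant of the scaling relation.\<close>
lemma bounded_drift:
  fixes h :: "nat \<Rightarrow> real"
  assumes step: "\<And>N. \<bar>h (Suc N) - h N - c\<bar> \<le> e" and bound: "\<And>N. \<bar>h N\<bar> \<le> B"
  shows "\<bar>c\<bar> \<le> e"
proof (rule ccontr)
  assume "\<not> \<bar>c\<bar> \<le> e"
  then have gap: "0 < \<bar>c\<bar> - e" by simp
  have lin: "\<bar>h N - h 0 - real N * c\<bar> \<le> real N * e" for N
  proof (induction N)
    case (Suc N)
    then show ?case using step[of N] by (simp add: algebra_simps)
  qed simp
  obtain N where N: "2 * B < real N * (\<bar>c\<bar> - e)"
    using reals_Archimedean3[OF gap] by blast
  have "real N * \<bar>c\<bar> = \<bar>real N * c\<bar>" by (simp add: abs_mult)
  also have "\<dots> \<le> real N * e + 2 * B" using lin[of N] bound[of N] bound[of 0] by linarith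
  finally show False using N by (simp add: algebra_simps)
qed

text \<open>The sequences \<open>G\<close> are the values of \<open>\<psi>\<^sub>1, \<psi>\<^sub>2, \<dots>\<close> along the orbit of \<open>w\<close>, with the index
lowered by one so that \<open>n\<close> becomes the exponent of \<open>\<delta>\<^sub>2\<close> in the renormalization. Continuity
of \<open>\<psi>\<^sub>n\<^sub>+\<^sub>1\<close> on a compact space is condensed into boundedness.\<close>
locale primitive_tower =
  fixes \<sigma> :: "letter \<Rightarrow> letter list" and lam :: nat and w :: "nat \<Rightarrow> letter"
    and p :: "letter \<Rightarrow> real" and G :: "nat \<Rightarrow> nat \<Rightarrow> real"
  assumes uniform: "uniform_subst lam \<sigma>" and lam2: "2 \<le> lam"
    and w_block: "\<And>N r. r < lam \<Longrightarrow> w (lam * N + r) = \<sigma> (w N) ! r"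
    and p_ne: "p La \<noteq> p Lb"
    and delta1: "delta \<sigma> p 1 = 0" and delta2: "delta \<sigma> p 2 \<noteq> 0"
    and G_0_Suc: "\<And>N. G 0 (Suc N) = G 0 N + p (w N)"
    and G_Suc_Suc: "\<And>n N. G (Suc n) (Suc N) = G (Suc n) N + G n N"
    and G_bounded: "\<And>n. \<exists>B. \<forall>N. \<bar>G n N\<bar> \<le> B"
begin

abbreviation \<delta> :: real where "\<delta> \<equiv> delta \<sigma> p 2"

lemma len [simp]: "length (\<sigma> \<alpha>) = lam"
  using uniform by (cases \<alpha>) (auto simp: uniform_subst_def)

lemma G_0_add: "G 0 (N + m) = G 0 N + (\<Sum>k<m. p (w (N + k)))"
  by (induction m) (auto simp: G_0_Suc)

lemma G_Suc_add: "G (Suc n) (N + m) = G (Suc n) N + (\<Sum>k<m. G n (N + k))"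
  by (induction m) (auto simp: G_Suc_Suc)

text \<open>Discrete Taylor expansion. The remainder is an iterated Birkhoff sum of the letters
that are passed, which is where the letter dependence of the block sums comes from.\<close>
lemma G_add:
  "G n (N + m) = (\<Sum>t\<le>n. real (m choose t) * G (n - t) N)
     + birkhoff p (\<lambda>k. w (N + k)) (Suc n) m"
proof (induction n arbitrary: m)
  case 0
  then show ?case by (simp add: G_0_add)
next
  case (Suc n)
  have "(\<Sum>k<m. \<Sum>t\<le>n. real (k choose t) * G (n - t) N)
      = (\<Sum>t\<le>n. (\<Sum>k<m. real (k choose t)) * G (n - t) N)"
    by (subst sum.swap) (simp add: sum_distrib_right)
  also have "\<dots> = (\<Sum>t\<le>n. real (m choose Suc t) * G (n - t) N)"
    by (simp flip: of_nat_sum add: sum_choose_lessThan)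
  finally have *: "(\<Sum>k<m. \<Sum>t\<le>n. real (k choose t) * G (n - t) N)
      = (\<Sum>t\<le>n. real (m choose Suc t) * G (n - t) N)" .
  have "G (Suc n) (N + m) = G (Suc n) N + (\<Sum>k<m. G n (N + k))" by (rule G_Suc_add)
  also have "(\<Sum>k<m. G n (N + k)) = (\<Sum>t\<le>n. real (m choose Suc t) * G (n - t) N)
      + birkhoff p (\<lambda>k. w (N + k)) (Suc (Suc n)) m"
    by (simp only: Suc.IH sum.distrib * birkhoff.simps(2)[of _ _ "Suc n"])
  finally show ?case by (simp add: sum.atMost_Suc_shift del: birkhoff.simps sum.atMost_Suc)
qed

text \<open>Every function of a letter is affine in \<open>p\<close>, as there are only two letters. The slope of the
block sum of order \<open>n + 1\<close> is \<open>\<delta>\<^sub>n\<^sub>+\<^sub>1\<close>; the intercept only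
contributes to a drift, which boundedness excludes.\<close>
definition block_rest :: "nat \<Rightarrow> real" where
  "block_rest n = birkhoff p ((!) (\<sigma> La)) (Suc n) lam - delta \<sigma> p (Suc n) * p La"

lemma birkhoff_block:
  "birkhoff p ((!) (\<sigma> \<alpha>)) (Suc n) lam = delta \<sigma> p (Suc n) * p \<alpha> + block_rest n"
proof (cases \<alpha>)
  case Lb
  have "birkhoff p ((!) (\<sigma> La)) (Suc n) lam - birkhoff p ((!) (\<sigma> Lb)) (Suc n) lam
      = delta \<sigma> p (Suc n) * (p La - p Lb)"
    using p_ne by (simp add: delta_def)
  then show ?thesis unfolding Lb block_rest_def by (simp add: algebra_simps del: birkhoff.simps)
qed (simp add: block_rest_def)

lemma birkhoff_w_block:
  assumes "m \<le> lam"
  shows "birkhoff p (\<lambda>k. w (lam * N + k)) (Suc n) m = birkhoff p ((!) (\<sigma> (w N))) (Suc n) m"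
  using assms by (intro birkhoff_cong) (simp add: w_block)

lemma G_block_step:
  "G n (lam * Suc N) = (\<Sum>t\<le>n. real (lam choose t) * G (n - t) (lam * N))
     + delta \<sigma> p (Suc n) * p (w N) + block_rest n"
  using G_add[of n "lam * N" lam] birkhoff_w_block[of lam N n] birkhoff_block[of "w N" n]
  by (simp add: add.commute del: birkhoff.simps)

text \<open>The recursion is what summation of the scaling relation over one block produces. In terms
of generating functions, \<open>coef j\<close> is the sequence of coefficients of
\<open>((1 + z)\<^sup>\<lambda> - 1)\<^sup>j\<close> times the series \<open>\<Sum>\<^sub>n \<delta>\<^sub>n\<^sub>+\<^sub>1 z\<^sup>n\<close>.\<close>
primrec coef :: "nat \<Rightarrow> nat \<Rightarrow> real" where
  "coef 0 n = delta \<sigma> p (Suc n)"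
| "coef (Suc j) n = (\<Sum>t\<in>{1..n}. real (lam choose t) * coef j (n - t))"

lemma coef_eq_0: "n \<le> j \<Longrightarrow> coef j n = 0"
proof (induction j arbitrary: n)
  case 0
  then show ?case using delta1 by simp
next
  case (Suc j)
  then show ?case by (auto intro!: sum.neutral)
qed

lemma coef_diag: "coef j (Suc j) = \<delta> * real lam ^ j"
proof (induction j)
  case 0
  then show ?case by (simp add: numeral_2_eq_2)
next
  case (Suc j)
  have "coef (Suc j) (Suc (Suc j)) = (\<Sum>t\<in>{1}. real (lam choose t) * coef j (Suc (Suc j) - t))"
    unfolding coef.simps(2) by (rule sum.mono_neutral_right) (auto simp: coef_eq_0)
  then show ?case by (simp add: Suc)
qed

definition offset :: "nat \<Rightarrow> real" where
  "offset n = G n 0 - (\<Sum>j<n. coef j n * G j 0)"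

lemma coef_sum_bounded:
  "\<exists>B. \<forall>N. \<bar>\<Sum>j<n. coef j m * G (f j) N\<bar> \<le> B"
proof -
  obtain B where B: "\<And>n N. \<bar>G n N\<bar> \<le> B n" using G_bounded by metis
  have "\<bar>\<Sum>j<n. coef j m * G (f j) N\<bar> \<le> (\<Sum>j<n. \<bar>coef j m\<bar> * B (f j))" for N
    by (rule order_trans[OF sum_abs sum_mono]) (auto simp: abs_mult B intro: mult_left_mono)
  then show ?thesis by blast
qed

text \<open>By induction on \<open>n\<close>: the increment of \<open>N \<mapsto> G n (\<lambda> N)\<close> involves only lower levels at
\<open>\<lambda> N\<close>, hence by hypothesis only \<open>G j N\<close> with \<open>j < n - 1\<close>, the letter \<open>w\<^sub>N\<close> and constants.
The first two kinds of terms are increments of \<open>G (j + 1)\<close> and \<open>G 0\<close>; what remains is a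
constant increment of a bounded sequence, hence zero.\<close>
lemma G_scale: "G n (lam * N) = (\<Sum>j<n. coef j n * G j N) + offset n"
proof (induction n arbitrary: N rule: less_induct)
  case (less n)
  define h where "h N = G n (lam * N) - (\<Sum>j<n. coef j n * G j N)" for N
  define c where "c = block_rest n + (\<Sum>t\<in>{1..n}. real (lam choose t) * offset (n - t))"
  have step: "h (Suc N) = h N + c" for N
  proof -
    have IH: "G (n - t) (lam * N) = (\<Sum>j<n-1. coef j (n - t) * G j N) + offset (n - t)"
      if "t \<in> {1..n}" for t
    proof -
      have "G (n - t) (lam * N) = (\<Sum>j<n-t. coef j (n - t) * G j N) + offset (n - t)"
        using that by (intro less.IH) auto
      also have "(\<Sum>j<n-t. coef j (n - t) * G j N) = (\<Sum>j<n-1. coef j (n - t) * G j N)"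
        using that by (intro sum.mono_neutral_left) (auto simp: coef_eq_0)
      finally show ?thesis .
    qed
    have "G n (lam * Suc N) - G n (lam * N)
        = (\<Sum>t\<in>{1..n}. real (lam choose t) * G (n - t) (lam * N))
          + delta \<sigma> p (Suc n) * p (w N) + block_rest n"
      unfolding G_block_step by (simp add: atMost_atLeast0 sum.atLeast_Suc_atMost)
    also have "(\<Sum>t\<in>{1..n}. real (lam choose t) * G (n - t) (lam * N))
        = (\<Sum>t\<in>{1..n}. \<Sum>j<n-1. real (lam choose t) * coef j (n - t) * G j N)
          + (\<Sum>t\<in>{1..n}. real (lam choose t) * offset (n - t))"
      by (simp add: IH ring_distribs sum.distrib sum_distrib_left mult.assoc)
    also have "(\<Sum>t\<in>{1..n}. \<Sum>j<n-1. real (lam choose t) * coef j (n - t) * G j N)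
        = (\<Sum>j<n-1. coef (Suc j) n * G j N)"
      by (subst sum.swap) (simp add: sum_distrib_right)
    finally have 1: "G n (lam * Suc N) - G n (lam * N)
        = (\<Sum>j<n-1. coef (Suc j) n * G j N) + delta \<sigma> p (Suc n) * p (w N) + c"
      by (simp add: c_def)
    have "(\<Sum>j<n. coef j n * G j (Suc N)) - (\<Sum>j<n. coef j n * G j N)
        = (\<Sum>j<n. coef j n * (G j (Suc N) - G j N))"
      by (simp add: right_diff_distrib sum_subtractf)
    also have "\<dots> = (\<Sum>j<n-1. coef (Suc j) n * G j N) + delta \<sigma> p (Suc n) * p (w N)"
    proof (cases n)
      case 0
      then show ?thesis using delta1 by simp
    next
      case (Suc n')
      then show ?thesis
        by (simp only: sum.lessThan_Suc_shift G_Suc_Suc G_0_Suc) simp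
    qed
    finally show ?thesis using 1 by (simp add: h_def)
  qed
  obtain B B' where "\<And>N. \<bar>G n N\<bar> \<le> B" "\<And>N. \<bar>\<Sum>j<n. coef j n * G (id j) N\<bar> \<le> B'"
    using G_bounded[of n] coef_sum_bounded[where f = id] by metis
  then have "\<bar>h N\<bar> \<le> B + B'" for N
    unfolding h_def id_apply by (intro order_trans[OF abs_triangle_ineq4 add_mono])
  with step have "c = 0" using bounded_drift[of h c 0 "B + B'"] by simp
  with step have "h N = h 0" for N by (induction N) auto
  then show ?case by (simp add: h_def offset_def algebra_simps)
qed

end

section \<open>Size of the scaling coefficients\<close>

text \<open>Exponents of \<open>\<lambda>\<close> in the renormalization are triangular numbers; this splits off the part
shared by the levels \<open>j\<close> and \<open>j + d\<close>.\<close>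
lemma triangle_add:
  "(j + d) * (j + d - 1) div 2 = j * (j - 1) div 2 + d * j + d * (d - 1) div (2::nat)"
proof -
  have "(j + d) * (j + d - 1) = j * (j - 1) + 2 * (d * j) + d * (d - 1)"
    by (cases j; cases d) (auto simp: algebra_simps)
  moreover have "even (j * (j - 1))" "even (d * (d - 1))" by (cases j; cases d; simp)+
  ultimately show ?thesis by (simp add: div_add)
qed

text \<open>A quadratic exponent beats any fixed base: with \<open>K \<le> q\<^sup>D\<close> only the finitely many
\<open>d \<le> 2 D + 1\<close> can fail \<open>D d \<le> d (d - 1) / 2\<close>, and the constant covers them.\<close>
lemma power_le_triangle_power:
  fixes K :: real
  assumes "2 \<le> (q :: real)" "0 \<le> K"
  shows "\<exists>C\<ge>0. \<forall>d. K ^ d \<le> C * q ^ (d * (d - 1) div 2)"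
proof -
  obtain D where D: "K \<le> q ^ D"
    using real_arch_pow[of q K] assms by (auto intro: less_imp_le)
  have "K ^ d \<le> q ^ (D * (2 * D + 1)) * q ^ (d * (d - 1) div 2)" for d
  proof -
    have "2 * (D * d) \<le> 2 * (D * (2 * D + 1)) + d * (d - 1)"
    proof (cases "d \<le> 2 * D + 1")
      case True
      then have "D * d \<le> D * (2 * D + 1)" by (rule mult_le_mono2)
      then show ?thesis by simp
    next
      case False
      then have "2 * D * d \<le> (d - 1) * d" by (intro mult_le_mono1) simp
      moreover have "2 * D * d = 2 * (D * d)" "(d - 1) * d = d * (d - 1)" by simp_all
      ultimately show ?thesis by linarith
    qed
    then have "D * d \<le> D * (2 * D + 1) + d * (d - 1) div 2" by linarith
    then have "q ^ (D * d) \<le> q ^ (D * (2 * D + 1) + d * (d - 1) div 2)"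
      using assms by (intro power_increasing) auto
    moreover have "K ^ d \<le> (q ^ D) ^ d" using D assms by (intro power_mono) auto
    ultimately show ?thesis by (simp add: power_mult power_add)
  qed
  moreover have "0 \<le> q ^ (D * (2 * D + 1))" using assms by simp
  ultimately show ?thesis by blast
qed

lemma one_plus_half_inverse_power:
  assumes "0 < (m :: nat)"
  shows "(1 + 1 / (2 * real m)) ^ m \<le> 7 / 4"
proof -
  have "(1 + 1 / (2 * real m)) ^ m \<le> exp (1 / (2 * real m)) ^ m"
    by (intro power_mono) (auto simp: exp_ge_add_one_self)
  also have "\<dots> = exp (1 / 2)" using assms by (simp flip: exp_of_nat_mult)
  also have "\<dots> \<le> 1 + 1 / 2 + (1 / 2)\<^sup>2" by (rule exp_bound) auto
  finally show ?thesis by (simp add: power2_eq_square)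
qed

context primitive_tower
begin

lemma lam_pos: "0 < lam" using lam2 by simp

text \<open>Evaluation of the generating function at \<open>z = 1 / (2 \<lambda>)\<close>. The point is chosen so that
\<open>(1 + z)\<^sup>\<lambda> - 1 \<le> 3/4\<close>, a base below 1 in \<open>j\<close>; this is what later makes the whole sum over
the lower levels, and not just each term, small.\<close>
lemma coef_bound: "\<exists>C\<ge>0. \<forall>j n. \<bar>coef j n\<bar> \<le> C * (3 / 4) ^ j * (2 * real lam) ^ n"
proof -
  define P where "P = \<bar>p La\<bar> + \<bar>p Lb\<bar>"
  have P: "\<bar>p \<alpha>\<bar> \<le> P" for \<alpha> by (cases \<alpha>) (auto simp: P_def)
  define C where "C = 2 * P * real lam / \<bar>p La - p Lb\<bar>"
  have C0: "0 \<le> C" by (auto simp: C_def P_def)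
  have base: "\<bar>delta \<sigma> p (Suc n)\<bar> \<le> C * (2 * real lam) ^ n" for n
  proof -
    have "\<bar>birkhoff p ((!) (\<sigma> La)) (Suc n) lam - birkhoff p ((!) (\<sigma> Lb)) (Suc n) lam\<bar>
        \<le> P * real lam ^ Suc n + P * real lam ^ Suc n"
      by (rule order_trans[OF abs_triangle_ineq4 add_mono]; rule birkhoff_bound) (use P in auto)
    then have "\<bar>delta \<sigma> p (Suc n)\<bar> \<le> (2 * P * real lam ^ Suc n) / \<bar>p La - p Lb\<bar>"
      unfolding delta_def len abs_divide by (intro divide_right_mono) auto
    also have "\<dots> = C * real lam ^ n" by (simp add: C_def)
    also have "\<dots> \<le> C * (2 * real lam) ^ n"
      using C0 by (intro mult_left_mono power_mono) auto
    finally show ?thesis .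
  qed
  have lam0: "0 < real lam" using lam_pos by simp
  have weight: "(\<Sum>t\<in>{1..n}. real (lam choose t) / (2 * real lam) ^ t) \<le> 3 / 4" for n
  proof -
    \<comment> \<open>the truncation at \<open>n\<close> is removed, in order to apply the binomial theorem\<close>
    have "(\<Sum>t\<in>{1..n}. real (lam choose t) / (2 * real lam) ^ t)
        \<le> (\<Sum>t\<in>{1..max n lam}. real (lam choose t) / (2 * real lam) ^ t)"
      by (rule sum_mono2) auto
    also have "\<dots> = (\<Sum>t\<in>{1..lam}. real (lam choose t) / (2 * real lam) ^ t)"
      by (rule sum.mono_neutral_right) (auto simp: binomial_eq_0)
    also have "\<dots> = (\<Sum>t\<le>lam. real (lam choose t) / (2 * real lam) ^ t) - 1"
      by (simp add: atMost_atLeast0 sum.atLeast_Suc_atMost)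
    also have "(\<Sum>t\<le>lam. real (lam choose t) / (2 * real lam) ^ t) = (1 / (2 * real lam) + 1) ^ lam"
      unfolding binomial_ring by (simp add: power_divide)
    finally show ?thesis using one_plus_half_inverse_power[OF lam_pos] by (simp add: add.commute)
  qed
  have "\<bar>coef j n\<bar> \<le> C * (3 / 4) ^ j * (2 * real lam) ^ n" for j n
  proof (induction j arbitrary: n)
    case 0
    then show ?case using base by simp
  next
    case (Suc j)
    let ?K = "C * (3 / 4) ^ j * (2 * real lam) ^ n"
    have "\<bar>coef (Suc j) n\<bar> \<le> (\<Sum>t\<in>{1..n}. real (lam choose t) * \<bar>coef j (n - t)\<bar>)"
      unfolding coef.simps(2) by (rule order_trans[OF sum_abs]) (simp add: abs_mult)
    also have "\<dots> \<le> (\<Sum>t\<in>{1..n}. real (lam choose t) * (C * (3 / 4) ^ j * (2 * real lam) ^ (n - t)))"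
      using Suc by (intro sum_mono mult_left_mono) auto
    also have "\<dots> = (\<Sum>t\<in>{1..n}. real (lam choose t) / (2 * real lam) ^ t) * ?K"
      unfolding sum_distrib_right using lam0 by (intro sum.cong) (auto simp: power_diff field_simps)
    also have "\<dots> \<le> 3 / 4 * ?K" using weight C0 by (intro mult_right_mono) auto
    finally show ?case by simp
  qed
  with C0 show ?thesis by blast
qed

text \<open>\<open>R n\<close> is the renormalizing factor of \<open>\<psi>\<^sub>n\<^sub>+\<^sub>1\<close>.\<close>
definition R :: "nat \<Rightarrow> real" where
  "R n = \<delta> ^ n * real lam ^ (n * (n - 1) div 2)"

lemma R_0 [simp]: "R 0 = 1" by (simp add: R_def)

lemma R_add: "R (j + d) = R j * (\<delta> ^ d * real lam ^ (d * j) * real lam ^ (d * (d - 1) div 2))"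
  by (simp only: R_def triangle_add power_add) (simp add: mult_ac)

lemma R_Suc: "R (Suc n) = \<delta> * real lam ^ n * R n"
  using R_add[of n 1] by simp

lemma R_ne: "R n \<noteq> 0" using lam_pos delta2 by (simp add: R_def)

lemma R_pos: "0 < \<bar>R n\<bar>" using R_ne by simp

text \<open>With \<open>d = n - j \<ge> 2\<close>, the quotient of \<open>R n\<close> by \<open>R j\<close> contains \<open>\<lambda>\<^sup>d\<^sup>j\<close>, which absorbs
\<open>(2 \<lambda>)\<^sup>j\<close> as soon as \<open>2 \<lambda> \<le> \<lambda>\<^sup>d\<close>, and \<open>\<lambda>\<close> to the power \<open>d (d - 1) / 2\<close>, which absorbs any
geometric sequence in \<open>d\<close>. For \<open>d = 1\<close>, the leading coefficient, the ratio is 1 instead.\<close>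
lemma coef_negligible:
  "\<exists>C\<ge>0. \<forall>j n. j + 2 \<le> n \<longrightarrow> \<bar>coef j n\<bar> * \<bar>R j\<bar> \<le> C * (3 / 4) ^ n * \<bar>R n\<bar>"
proof -
  obtain C1 where C1: "0 \<le> C1" "\<And>j n. \<bar>coef j n\<bar> \<le> C1 * (3 / 4) ^ j * (2 * real lam) ^ n"
    using coef_bound by blast
  define K where "K = 2 * real lam / (3 / 4 * \<bar>\<delta>\<bar>)"
  obtain C2 where C2: "0 \<le> C2" "\<And>d. K ^ d \<le> C2 * real lam ^ (d * (d - 1) div 2)"
    using power_le_triangle_power[of "real lam" K] lam2 by (auto simp: K_def)
  have "\<bar>coef j n\<bar> * \<bar>R j\<bar> \<le> C1 * C2 * (3 / 4) ^ n * \<bar>R n\<bar>" if "j + 2 \<le> n" for j n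
  proof -
    define d where "d = n - j"
    have n: "n = j + d" and d: "2 \<le> d" using that by (auto simp: d_def)
    have "(2 * real lam) ^ j \<le> (real lam ^ 2) ^ j"
      using lam2 by (intro power_mono) (auto simp: power2_eq_square)
    also have "\<dots> \<le> real lam ^ (d * j)"
      using power_increasing[of "2 * j" "d * j" "real lam"] lam2 d by (simp add: power_mult)
    finally have 1: "(2 * real lam) ^ j \<le> real lam ^ (d * j)" .
    have "2 * real lam = K * (3 / 4 * \<bar>\<delta>\<bar>)" using delta2 by (simp add: K_def)
    then have "(2 * real lam) ^ d = K ^ d * ((3 / 4) ^ d * \<bar>\<delta>\<bar> ^ d)"
      by (simp only: power_mult_distrib)
    also have "\<dots> \<le> (C2 * real lam ^ (d * (d - 1) div 2)) * ((3 / 4) ^ d * \<bar>\<delta>\<bar> ^ d)"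
      by (intro mult_right_mono C2) auto
    finally have 2: "(2 * real lam) ^ d
        \<le> (C2 * real lam ^ (d * (d - 1) div 2)) * ((3 / 4) ^ d * \<bar>\<delta>\<bar> ^ d)" .
    have "\<bar>coef j n\<bar> \<le> C1 * (3 / 4) ^ j * ((2 * real lam) ^ j * (2 * real lam) ^ d)"
      using C1(2)[of j n] by (simp only: n power_add)
    also have "\<dots> \<le> C1 * (3 / 4) ^ j * (real lam ^ (d * j)
        * ((C2 * real lam ^ (d * (d - 1) div 2)) * ((3 / 4) ^ d * \<bar>\<delta>\<bar> ^ d)))"
      using C1(1) by (intro mult_left_mono mult_mono 1 2) auto
    finally have "\<bar>coef j n\<bar> * \<bar>R j\<bar> \<le> C1 * (3 / 4) ^ j * (real lam ^ (d * j)
        * ((C2 * real lam ^ (d * (d - 1) div 2)) * ((3 / 4) ^ d * \<bar>\<delta>\<bar> ^ d))) * \<bar>R j\<bar>"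
      by (intro mult_right_mono) auto
    also have "\<dots> = C1 * C2 * (3 / 4) ^ n * \<bar>R n\<bar>"
      by (simp only: n R_add abs_mult power_abs power_add abs_of_nat mult_ac)
    finally show ?thesis .
  qed
  moreover have "0 \<le> C1 * C2" using C1 C2 by simp
  ultimately show ?thesis by blast
qed

section \<open>Growth of the primitives\<close>

text \<open>Within a block \<open>G (n + 1)\<close> moves only by multiples of the previous level, which is small
compared with \<open>R (n + 1)\<close>. So it suffices to control \<open>G\<close> at the starting points of blocks.\<close>
lemma G_within_block:
  assumes "\<And>N. \<bar>G n N\<bar> \<le> c" "r \<le> lam"
  shows "\<bar>G (Suc n) (N + r) - G (Suc n) N\<bar> \<le> real lam * c"
proof -
  have c: "0 \<le> c" using assms(1)[of 0] by linarith
  have "\<bar>\<Sum>k<r. G n (N + k)\<bar> \<le> (\<Sum>k<r. c)"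
    by (rule order_trans[OF sum_abs sum_mono]) (use assms in auto)
  also have "\<dots> \<le> real lam * c" using assms(2) c by (auto intro: mult_right_mono)
  finally show ?thesis by (simp add: G_Suc_add)
qed

text \<open>The constant in the scaling relation is found from one level higher. Over a block,
\<open>G (n + 2)\<close> increases by about \<open>\<lambda>\<close> times the value of \<open>G (n + 1)\<close> at the start of the block. All of
this but \<open>\<lambda>\<close> times the offset is an increment of a combination of bounded sequences, so
the offset cannot exceed the error made in replacing \<open>G (n + 1)\<close> by that value.\<close>
lemma offset_bound:
  assumes c: "\<And>N. \<bar>G n N\<bar> \<le> c"
  shows "\<bar>offset (Suc n)\<bar> \<le> real lam * c"
proof -
  define h where "h N = G (Suc (Suc n)) (lam * N)
    - real lam * (\<Sum>j<Suc n. coef j (Suc n) * G (Suc j) N)" for N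
  have step: "\<bar>h (Suc N) - h N - real lam * offset (Suc n)\<bar> \<le> real lam * (real lam * c)" for N
  proof -
    have "G (Suc (Suc n)) (lam * Suc N) - G (Suc (Suc n)) (lam * N)
        = (\<Sum>r<lam. G (Suc n) (lam * N + r))"
      using G_Suc_add[of "Suc n" "lam * N" lam] by (simp add: add.commute)
    moreover have shifted: "(\<Sum>j<Suc n. coef j (Suc n) * G (Suc j) (Suc N))
        - (\<Sum>j<Suc n. coef j (Suc n) * G (Suc j) N) = G (Suc n) (lam * N) - offset (Suc n)"
      by (simp only: G_scale[of "Suc n"] G_Suc_Suc ring_distribs sum.distrib)
    ultimately have "h (Suc N) - h N - real lam * offset (Suc n)
        = (\<Sum>r<lam. G (Suc n) (lam * N + r)) - real lam * G (Suc n) (lam * N)"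
      using arg_cong[OF shifted, of "(*) (real lam)"]
      unfolding h_def right_diff_distrib by linarith
    also have "\<dots> = (\<Sum>r<lam. G (Suc n) (lam * N + r) - G (Suc n) (lam * N))"
      by (simp add: sum_subtractf)
    also have "\<bar>\<dots>\<bar> \<le> (\<Sum>r<lam. real lam * c)"
      by (rule order_trans[OF sum_abs sum_mono]) (auto intro!: G_within_block c)
    finally show ?thesis by simp
  qed
  obtain B B' where "\<And>N. \<bar>G (Suc (Suc n)) N\<bar> \<le> B"
    "\<And>N. \<bar>\<Sum>j<Suc n. coef j (Suc n) * G (Suc j) N\<bar> \<le> B'"
    using G_bounded[of "Suc (Suc n)"]
      coef_sum_bounded[where f = Suc and n = "Suc n" and m = "Suc n"] by metis
  then have "\<bar>h N\<bar> \<le> B + real lam * B'" for N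
    unfolding h_def
    by (intro order_trans[OF abs_triangle_ineq4 add_mono]) (auto simp: abs_mult intro: mult_left_mono)
  from bounded_drift[of h, OF step this] show ?thesis using lam_pos by (simp add: abs_mult)
qed

text \<open>The errors are the variation within a block and the offset, together giving the geometric
part of \<open>s\<close>, and the lower terms of the scaling relation, giving the part with \<open>3/4\<close>.
The bound \<open>B\<close> is kept as a parameter, since at this stage it may still depend on \<open>i\<close>.\<close>
lemma scaling_error:
  "\<exists>s. summable s \<and> (\<forall>i. 0 \<le> s i) \<and>
    (\<forall>i B. (\<forall>j\<le>i. \<forall>N. \<bar>G j N\<bar> \<le> B * \<bar>R j\<bar>) \<longrightarrow>
      (\<forall>N r. r < lam \<longrightarrow>
        \<bar>G (Suc i) (lam * N + r) - \<delta> * real lam ^ i * G i N\<bar> \<le> s i * B * \<bar>R (Suc i)\<bar>))"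
proof -
  obtain C where C: "0 \<le> C"
    "\<And>j n. j + 2 \<le> n \<Longrightarrow> \<bar>coef j n\<bar> * \<bar>R j\<bar> \<le> C * (3 / 4) ^ n * \<bar>R n\<bar>"
    using coef_negligible by blast
  define s where
    "s i = 2 * real lam / \<bar>\<delta>\<bar> * (1 / real lam) ^ i + C * (real i * (3 / 4) ^ Suc i)" for i
  have "summable (\<lambda>i. real i * (3 / 4 :: real) ^ i)"
    by (rule summable_ratio_test[where c = "7/8" and N = 6]) (auto simp: field_simps)
  then have "summable (\<lambda>i. 3 / 4 * (real i * (3 / 4 :: real) ^ i))" by (rule summable_mult)
  then have "summable (\<lambda>i. real i * (3 / 4 :: real) ^ Suc i)" by (simp add: mult_ac)
  then have "summable s" unfolding s_def
    using lam2 by (intro summable_add summable_mult summable_geometric) auto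
  moreover have "0 \<le> s i" for i using C by (simp add: s_def)
  moreover have "\<bar>G (Suc i) (lam * N + r) - \<delta> * real lam ^ i * G i N\<bar> \<le> s i * B * \<bar>R (Suc i)\<bar>"
    if B: "\<And>j N. j \<le> i \<Longrightarrow> \<bar>G j N\<bar> \<le> B * \<bar>R j\<bar>" and r: "r < lam" for i B N r
  proof -
    have B0: "0 \<le> B" using B[of 0 0] by simp
    have 1: "\<bar>G (Suc i) (lam * N + r) - G (Suc i) (lam * N)\<bar> \<le> real lam * (B * \<bar>R i\<bar>)"
      using B r by (intro G_within_block) auto
    have 2: "\<bar>offset (Suc i)\<bar> \<le> real lam * (B * \<bar>R i\<bar>)"
      using B by (intro offset_bound) auto
    have "\<bar>coef j (Suc i) * G j N\<bar> \<le> B * C * (3 / 4) ^ Suc i * \<bar>R (Suc i)\<bar>" if "j < i" for j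
    proof -
      have "\<bar>coef j (Suc i) * G j N\<bar> \<le> \<bar>coef j (Suc i)\<bar> * (B * \<bar>R j\<bar>)"
        using that B by (auto simp: abs_mult intro!: mult_left_mono)
      also have "\<dots> \<le> B * (C * (3 / 4) ^ Suc i * \<bar>R (Suc i)\<bar>)"
        using mult_left_mono[OF C(2)[of j "Suc i"] B0] that by (simp only: mult_ac)
      finally show ?thesis by (simp only: mult.assoc)
    qed
    then have 3: "\<bar>\<Sum>j<i. coef j (Suc i) * G j N\<bar> \<le> real i * (B * C * (3 / 4) ^ Suc i * \<bar>R (Suc i)\<bar>)"
      using sum_bounded_above[of "{..<i}" "\<lambda>j. \<bar>coef j (Suc i) * G j N\<bar>"
          "B * C * (3 / 4) ^ Suc i * \<bar>R (Suc i)\<bar>"]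
      by (intro order_trans[OF sum_abs]) auto
    have 4: "G (Suc i) (lam * N)
        = (\<Sum>j<i. coef j (Suc i) * G j N) + \<delta> * real lam ^ i * G i N + offset (Suc i)"
      unfolding G_scale[of "Suc i"] by (simp only: sum.lessThan_Suc coef_diag)
    have "\<bar>G (Suc i) (lam * N + r) - \<delta> * real lam ^ i * G i N\<bar>
        \<le> 2 * (real lam * (B * \<bar>R i\<bar>)) + real i * (B * C * (3 / 4) ^ Suc i * \<bar>R (Suc i)\<bar>)"
      using 1 2 3 4 by linarith
    also have "2 * (real lam * (B * \<bar>R i\<bar>))
        = 2 * real lam / \<bar>\<delta>\<bar> * (1 / real lam) ^ i * B * \<bar>R (Suc i)\<bar>"
      using delta2 lam_pos by (simp add: R_Suc abs_mult power_divide field_simps)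
    finally show ?thesis by (simp add: s_def algebra_simps)
  qed
  ultimately show ?thesis by (intro exI[of _ s]) auto
qed

text \<open>Each level multiplies the bound on \<open>G n / R n\<close> by at most \<open>1 + s n\<close>, and the infinite
product of these factors converges. The resulting uniform bound then makes the
scaling errors summable.\<close>
lemma growth_estimate:
  "\<exists>B s. summable s \<and> (\<forall>n N. \<bar>G n N\<bar> \<le> B * \<bar>R n\<bar>) \<and>
    (\<forall>i N r. r < lam \<longrightarrow>
      \<bar>G (Suc i) (lam * N + r) - \<delta> * real lam ^ i * G i N\<bar> \<le> s i * \<bar>R (Suc i)\<bar>)"
proof -
  obtain s where s: "summable s" "\<And>i. 0 \<le> s i"
    and step: "\<And>i B N r. (\<And>j N. j \<le> i \<Longrightarrow> \<bar>G j N\<bar> \<le> B * \<bar>R j\<bar>) \<Longrightarrow> r < lam \<Longrightarrow>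
        \<bar>G (Suc i) (lam * N + r) - \<delta> * real lam ^ i * G i N\<bar> \<le> s i * B * \<bar>R (Suc i)\<bar>"
    using scaling_error by metis
  obtain B0 where B0: "\<And>N. \<bar>G 0 N\<bar> \<le> B0" using G_bounded by blast
  have B0': "0 \<le> B0" using B0[of 0] by linarith
  define \<beta> where "\<beta> n = B0 * (\<Prod>i<n. 1 + s i)" for n
  have \<beta>0: "0 \<le> \<beta> n" for n unfolding \<beta>_def using B0' s(2)
    by (intro mult_nonneg_nonneg prod_nonneg) (auto intro: add_nonneg_nonneg)
  have \<beta>_mono: "\<beta> n \<le> \<beta> (Suc n)" for n
    using mult_left_mono[OF _ \<beta>0, of 1 "1 + s n" n] s(2) by (simp add: \<beta>_def mult_ac)
  have bound: "j \<le> n \<Longrightarrow> \<bar>G j N\<bar> \<le> \<beta> n * \<bar>R j\<bar>" for j n N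
  proof (induction n arbitrary: j N)
    case 0
    then show ?case using B0 by (simp add: \<beta>_def)
  next
    case (Suc n)
    show ?case
    proof (cases "j \<le> n")
      case True
      then show ?thesis using Suc.IH[of j N] \<beta>_mono[of n]
        by (meson order_trans mult_right_mono abs_ge_zero)
    next
      case False
      then have j: "j = Suc n" using Suc.prems by simp
      define q r where "q = N div lam" and "r = N mod lam"
      have r: "r < lam" and N: "N = lam * q + r" using lam_pos by (auto simp: q_def r_def)
      have "\<bar>G (Suc n) N - \<delta> * real lam ^ n * G n q\<bar> \<le> s n * \<beta> n * \<bar>R (Suc n)\<bar>"
        unfolding N by (rule step[OF Suc.IH r]) auto
      moreover have "\<bar>\<delta> * real lam ^ n * G n q\<bar> \<le> \<beta> n * \<bar>R (Suc n)\<bar>"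
        using mult_left_mono[OF Suc.IH[OF le_refl, of q], of "\<bar>\<delta>\<bar> * real lam ^ n"]
        by (simp add: R_Suc abs_mult mult_ac)
      ultimately have "\<bar>G (Suc n) N\<bar> \<le> s n * \<beta> n * \<bar>R (Suc n)\<bar> + \<beta> n * \<bar>R (Suc n)\<bar>"
        by linarith
      then show ?thesis by (simp add: j \<beta>_def algebra_simps)
    qed
  qed
  define B where "B = B0 * exp (suminf s)"
  have "\<beta> n \<le> B" for n
  proof -
    have "(\<Prod>i<n. 1 + s i) \<le> (\<Prod>i<n. exp (s i))"
      by (intro prod_mono) (auto simp: s(2) add_nonneg_nonneg exp_ge_add_one_self)
    also have "\<dots> = exp (sum s {..<n})" by (simp add: exp_sum)
    also have "\<dots> \<le> exp (suminf s)" using s by (simp add: sum_le_suminf)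
    finally show ?thesis unfolding \<beta>_def B_def using B0' by (intro mult_left_mono)
  qed
  then have B: "\<bar>G n N\<bar> \<le> B * \<bar>R n\<bar>" for n N
    using bound[of n n N] by (meson order_trans mult_right_mono abs_ge_zero le_refl)
  have "summable (\<lambda>i. s i * B)" using s(1) by (rule summable_mult2)
  with B step[OF B] show ?thesis by blast
qed

section \<open>Exact values along blocks\<close>

text \<open>Modulo constants, scaling by \<open>\<lambda>\<close> lowers the level by at least one. After \<open>n\<close> scalings
of \<open>G n\<close> only \<open>G 0\<close> is left, reached solely through the leading coefficients, whose product is
\<open>R n\<close>; starting from a lower level, nothing is left. No approximation is involved.\<close>
lemma G_top_scale:
  "j \<le> n \<Longrightarrow> G j (lam ^ n * N) - G j 0 = (if j = n then R n * (G 0 N - G 0 0) else 0)"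
proof (induction n arbitrary: j)
  case 0
  then show ?case by simp
next
  case (Suc n)
  have "G j (lam ^ Suc n * N) - G j 0
      = (\<Sum>i<j. coef i j * (G i (lam ^ n * N) - G i 0))"
    using G_scale[of j "lam ^ n * N"]
    by (simp add: offset_def right_diff_distrib sum_subtractf mult.assoc)
  also have "\<dots> = (\<Sum>i<j. if i = n then coef i j * (R n * (G 0 N - G 0 0)) else 0)"
    using Suc by (intro sum.cong) auto
  also have "\<dots> = (if n < j then coef n j * (R n * (G 0 N - G 0 0)) else 0)"
    by (simp add: sum.delta)
  finally show ?case using Suc.prems by (auto simp: coef_diag R_Suc)
qed

lemma w_determined: "w k = w l \<Longrightarrow> m < lam ^ i \<Longrightarrow> w (lam ^ i * k + m) = w (lam ^ i * l + m)"
proof (induction i arbitrary: m)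
  case (Suc i)
  define q r where "q = m div lam" and "r = m mod lam"
  have r: "r < lam" and m: "m = lam * q + r" using lam_pos by (auto simp: q_def r_def)
  have q: "q < lam ^ i"
    using Suc.prems lam_pos by (simp add: q_def less_mult_imp_div_less mult.commute)
  have e: "lam ^ Suc i * k + m = lam * (lam ^ i * k + q) + r" for k
    by (simp add: m algebra_simps)
  show ?case unfolding e w_block[OF r] Suc.IH[OF Suc.prems(1) q] ..
qed simp

text \<open>The position inside a block of order \<open>i + 1\<close> is split into a block of order \<open>i\<close> and a
remainder below \<open>\<lambda>\<close>. The remainder is handled by the Taylor expansion, whose letters
are determined, and scaling reduces the rest to levels below \<open>n\<close> and to order \<open>i\<close>.\<close>
lemma G_determined:
  "w k = w l \<Longrightarrow> m < lam ^ i \<Longrightarrow> n < i \<Longrightarrow> G n (lam ^ i * k + m) = G n (lam ^ i * l + m)"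
proof (induction i arbitrary: m n)
  case (Suc i)
  define q r where "q = m div lam" and "r = m mod lam"
  have r: "r < lam" and m: "m = lam * q + r" using lam_pos by (auto simp: q_def r_def)
  have q: "q < lam ^ i"
    using Suc.prems lam_pos by (simp add: q_def less_mult_imp_div_less mult.commute)
  have e: "lam ^ Suc i * k + m = lam * (lam ^ i * k + q) + r" for k
    by (simp add: m algebra_simps)
  have scaled: "G t (lam * (lam ^ i * k + q)) = G t (lam * (lam ^ i * l + q))" if "t \<le> n" for t
    unfolding G_scale using Suc.IH[OF Suc.prems(1) q] Suc.prems(3) that by simp
  show ?case
    unfolding e G_add[of n _ r] birkhoff_w_block[OF less_imp_le[OF r]] w_determined[OF Suc.prems(1) q]
    by (simp only: scaled diff_le_self)
qed simp

lemma G_block_start: "n < i \<Longrightarrow> G n (lam ^ i * k) = G n 0"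
  using G_top_scale[of n i k] by simp

section \<open>The limit of the renormalized step functions\<close>

text \<open>The step function \<open>f\<^sub>w\<close> of level \<open>n + 1\<close>; since \<open>R 0 = 1\<close>, the level \<open>F 0\<close> is \<open>\<psi>\<^sub>1\<close> itself.\<close>
definition F :: "nat \<Rightarrow> real \<Rightarrow> real" where
  "F n x = G n (nat \<lfloor>real lam ^ n * x\<rfloor>) / R n"

lemma F_cell:
  assumes "real m \<le> real lam ^ n * x" "real lam ^ n * x < real m + 1"
  shows "F n x = G n m / R n"
proof -
  have "\<lfloor>real lam ^ n * x\<rfloor> = int m" using assms by (intro floor_unique) auto
  then show ?thesis by (simp add: F_def)
qed

lemma F_bounded: "\<exists>B. \<forall>n x. \<bar>F n x\<bar> \<le> B"
proof -
  obtain B where "\<And>n N. \<bar>G n N\<bar> \<le> B * \<bar>R n\<bar>" using growth_estimate by metis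
  then have "\<bar>F n x\<bar> \<le> B" for n x
    using R_pos by (simp add: F_def field_simps)
  then show ?thesis by blast
qed

text \<open>The cell of \<open>x\<close> at level \<open>n\<close> is obtained from the one at level \<open>n + 1\<close> by division by
\<open>\<lambda>\<close>, so the scaling estimate compares the two values; \<open>R (n + 1) = \<delta>\<^sub>2 \<lambda>\<^sup>n R n\<close> matches the
leading coefficient.\<close>
lemma F_increment: "\<exists>s. summable s \<and> (\<forall>n x. 0 \<le> x \<longrightarrow> \<bar>F (Suc n) x - F n x\<bar> \<le> s n)"
proof -
  obtain s where s: "summable s"
    "\<And>i N r. r < lam \<Longrightarrow>
      \<bar>G (Suc i) (lam * N + r) - \<delta> * real lam ^ i * G i N\<bar> \<le> s i * \<bar>R (Suc i)\<bar>"
    using growth_estimate by metis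
  have "\<bar>F (Suc n) x - F n x\<bar> \<le> s n" if x: "0 \<le> x" for n x
  proof -
    define m where "m = nat \<lfloor>real lam ^ Suc n * x\<rfloor>"
    have "real lam ^ n * x = real lam ^ Suc n * x / of_int (int lam)" using lam_pos by simp
    then have "\<lfloor>real lam ^ n * x\<rfloor> = \<lfloor>real lam ^ Suc n * x\<rfloor> div int lam"
      by (simp only: floor_divide_real_eq_div of_nat_0_le_iff)
    then have q: "nat \<lfloor>real lam ^ n * x\<rfloor> = m div lam"
      using x by (simp add: m_def nat_div_distrib)
    have "\<bar>G (Suc n) m - \<delta> * real lam ^ n * G n (m div lam)\<bar> \<le> s n * \<bar>R (Suc n)\<bar>"
      using s(2)[of "m mod lam" n "m div lam"] lam_pos by simp
    moreover have "F (Suc n) x - F n x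
        = (G (Suc n) m - \<delta> * real lam ^ n * G n (m div lam)) / R (Suc n)"
      unfolding F_def q m_def[symmetric] R_Suc
      using R_ne[of n] delta2 lam_pos by (simp add: field_simps)
    ultimately show ?thesis
      using R_pos[of "Suc n"] by (simp add: abs_divide pos_divide_le_eq)
  qed
  with s(1) show ?thesis by blast
qed

lemma F_uniform_limit: "\<exists>f. uniform_limit {0..} F f sequentially"
proof -
  obtain s where "summable s" "\<And>n x. 0 \<le> x \<Longrightarrow> \<bar>F (Suc n) x - F n x\<bar> \<le> s n"
    using F_increment by blast
  then have "uniform_limit {0..} (\<lambda>n x. \<Sum>i<n. F (Suc i) x - F i x)
      (\<lambda>x. \<Sum>i. F (Suc i) x - F i x) sequentially"
    by (intro Weierstrass_m_test[where M = s]) auto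
  then have "uniform_limit {0..} (\<lambda>n x. F 0 x + (\<Sum>i<n. F (Suc i) x - F i x))
      (\<lambda>x. F 0 x + (\<Sum>i. F (Suc i) x - F i x)) sequentially"
    by (intro uniform_limit_add uniform_limit_const)
  moreover have "F 0 x + (\<Sum>i<n. F (Suc i) x - F i x) = F n x" for n x
    using sum_lessThan_telescope[of "\<lambda>i. F i x" n] by simp
  ultimately show ?thesis by auto
qed

text \<open>Points at distance below the mesh lie in the same or in adjacent cells, and the jump
between adjacent cells is a value of the previous level.\<close>
lemma F_oscillation:
  "\<exists>J. J \<longlonglongrightarrow> 0 \<and> (\<forall>n x y. 0 \<le> x \<longrightarrow> 0 \<le> y \<longrightarrow> \<bar>x - y\<bar> < 1 / real lam ^ Suc n \<longrightarrow>
     \<bar>F (Suc n) x - F (Suc n) y\<bar> \<le> J n)"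
proof -
  obtain B where B: "\<And>n N. \<bar>G n N\<bar> \<le> B * \<bar>R n\<bar>" using growth_estimate by metis
  have B0: "0 \<le> B" using B[of 0 0] by simp
  define J where "J n = B / \<bar>\<delta>\<bar> * (1 / real lam) ^ n" for n
  have "(\<lambda>n. B / \<bar>\<delta>\<bar> * (1 / real lam) ^ n) \<longlonglongrightarrow> B / \<bar>\<delta>\<bar> * 0"
    using lam2 by (intro tendsto_mult tendsto_const LIMSEQ_power_zero) auto
  then have "J \<longlonglongrightarrow> 0" by (simp add: J_def[abs_def])
  moreover have "\<bar>F (Suc n) x - F (Suc n) y\<bar> \<le> J n"
    if xy: "0 \<le> x" "0 \<le> y" "\<bar>x - y\<bar> < 1 / real lam ^ Suc n" for n x y
  proof -
    let ?L = "real lam ^ Suc n"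
    define a b where "a = nat \<lfloor>?L * x\<rfloor>" and "b = nat \<lfloor>?L * y\<rfloor>"
    have L: "0 < ?L" using lam_pos by simp
    have "?L * x - ?L * y = (x - y) * ?L" by (simp only: left_diff_distrib mult.commute)
    then have "\<bar>?L * x - ?L * y\<bar> = \<bar>x - y\<bar> * ?L"
      using L by (simp only: abs_mult abs_of_pos)
    then have "\<bar>?L * x - ?L * y\<bar> < 1"
      using xy(3) L by (simp only: pos_less_divide_eq)
    then have "\<bar>\<lfloor>?L * x\<rfloor> - \<lfloor>?L * y\<rfloor>\<bar> \<le> 1" by linarith
    moreover have "0 \<le> \<lfloor>?L * x\<rfloor>" "0 \<le> \<lfloor>?L * y\<rfloor>" using xy by auto
    ultimately have "a = b \<or> a = Suc b \<or> b = Suc a" unfolding a_def b_def by linarith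
    then have "\<bar>G (Suc n) a - G (Suc n) b\<bar> \<le> B * \<bar>R n\<bar>"
      using B[of n a] B[of n b] B0 by (auto simp: G_Suc_Suc)
    then have "\<bar>(G (Suc n) a - G (Suc n) b) / R (Suc n)\<bar> \<le> B * \<bar>R n\<bar> / \<bar>R (Suc n)\<bar>"
      unfolding abs_divide by (intro divide_right_mono) auto
    also have "\<dots> = J n"
      using R_pos[of n] by (simp add: J_def R_Suc abs_mult power_divide)
    finally show ?thesis by (simp add: F_def a_def b_def diff_divide_distrib)
  qed
  ultimately show ?thesis by blast
qed

lemma limit_continuous:
  assumes f: "uniform_limit {0..} F f sequentially"
  shows "continuous_on {0..} f"
  unfolding continuous_on_iff
proof (intro ballI allI impI)
  fix x :: real and e :: real
  assume x: "x \<in> {0..}" and e: "0 < e"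
  obtain J where J: "J \<longlonglongrightarrow> 0" "\<And>n x y. 0 \<le> x \<Longrightarrow> 0 \<le> y \<Longrightarrow>
     \<bar>x - y\<bar> < 1 / real lam ^ Suc n \<Longrightarrow> \<bar>F (Suc n) x - F (Suc n) y\<bar> \<le> J n"
    using F_oscillation by blast
  have "\<forall>\<^sub>F n in sequentially. \<forall>x\<in>{0..}. dist (F n x) (f x) < e / 3"
    using f e unfolding uniform_limit_iff by (meson divide_pos_pos zero_less_numeral)
  then have "\<forall>\<^sub>F n in sequentially. \<forall>x\<in>{0..}. dist (F (Suc n) x) (f x) < e / 3"
    by (subst eventually_sequentially_Suc)
  moreover have "\<forall>\<^sub>F n in sequentially. J n < e / 3"
    using J(1) e by (intro order_tendstoD(2)) auto
  ultimately have "\<forall>\<^sub>F n in sequentially. (\<forall>x\<in>{0..}. dist (F (Suc n) x) (f x) < e / 3) \<and> J n < e / 3"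
    by (rule eventually_conj)
  then obtain n where n: "\<And>x. 0 \<le> x \<Longrightarrow> dist (F (Suc n) x) (f x) < e / 3" "J n < e / 3"
    by (auto simp: eventually_sequentially)
  have "dist (f y) (f x) < e" if "0 \<le> y" "dist y x < 1 / real lam ^ Suc n" for y
    using n(1)[of x] n(1)[of y] n(2) J(2)[of y x n] that x
    unfolding dist_real_def atLeast_iff by linarith
  moreover have "0 < 1 / real lam ^ Suc n" using lam_pos by simp
  ultimately show "\<exists>d>0. \<forall>y\<in>{0..}. dist y x < d \<longrightarrow> dist (f y) (f x) < e"
    by (meson atLeast_iff)
qed

lemma limit_at_nat:
  assumes f: "uniform_limit {0..} F f sequentially"
  shows "f (real N) - f 0 = G 0 N - G 0 0"
proof -
  have "(\<lambda>n. F n (real N) - F n 0) \<longlonglongrightarrow> f (real N) - f 0"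
    using f by (intro tendsto_diff tendsto_uniform_limitI[OF f]) auto
  moreover have "F n (real N) - F n 0 = G 0 N - G 0 0" for n
  proof -
    have "nat \<lfloor>real lam ^ n * real N\<rfloor> = lam ^ n * N"
      by (simp flip: of_nat_power of_nat_mult)
    then show ?thesis
      using G_top_scale[of n n N] R_ne[of n] by (simp add: F_def field_simps)
  qed
  ultimately show ?thesis by (simp add: LIMSEQ_const_iff)
qed

text \<open>If the limit vanished on the block, \<open>G 0\<close> would be constant at the integers in it, so \<open>p\<close> would
vanish on all letters of \<open>\<sigma>(w\<^sub>N)\<close>, that is, on both letters.\<close>
lemma limit_nonzero_on_block:
  assumes f: "uniform_limit {0..} F f sequentially"
  shows "\<exists>x\<in>{0..real lam}. f (x + real lam * real N) \<noteq> 0"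
proof (rule ccontr)
  assume "\<not> ?thesis"
  then have zero: "f (x + real lam * real N) = 0" if "0 \<le> x" "x \<le> real lam" for x
    using that by auto
  have eq: "G 0 (lam * N + r) = G 0 (lam * N)" if "r \<le> lam" for r
    using limit_at_nat[OF f, of "lam * N + r"] limit_at_nat[OF f, of "lam * N"]
      zero[of "real r"] zero[of 0] that by (simp add: add.commute)
  have "p (\<sigma> (w N) ! r) = 0" if "r < lam" for r
    using eq[of r] eq[of "Suc r"] that by (simp add: G_0_Suc w_block)
  then have "p \<beta> = 0" for \<beta> using both_letters[OF uniform p_ne delta1 delta2, of "w N" \<beta>] by auto
  then show False using p_ne by simp
qed

text \<open>A cell of level \<open>n\<close> has length \<open>\<lambda>\<^sup>-\<^sup>n\<close>, and \<open>F n\<close> is constant on it except at its right end point.\<close>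
lemma F_has_integral:
  "(F n has_integral (\<Sum>k<M. G n k) / (R n * real lam ^ n)) {0..real M / real lam ^ n}"
proof (induction M)
  case 0
  then show ?case using has_integral_refl(2)[of "F n" 0] by simp
next
  case (Suc M)
  let ?L = "real lam ^ n"
  have L: "0 < ?L" using lam_pos by simp
  have "((\<lambda>x. G n M / R n) has_integral (G n M / R n) * (real (Suc M) / ?L - real M / ?L))
      {real M / ?L..real (Suc M) / ?L}"
    using has_integral_const_real[of "G n M / R n" "real M / ?L" "real (Suc M) / ?L"] L
    by (simp add: divide_right_mono content_real mult.commute)
  also have "(G n M / R n) * (real (Suc M) / ?L - real M / ?L) = G n M / (R n * ?L)"
    by (simp flip: diff_divide_distrib)
  finally have "(F n has_integral G n M / (R n * ?L)) {real M / ?L..real (Suc M) / ?L}"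
    by (rule has_integral_spike_finite[where S = "{real (Suc M) / ?L}", rotated 2])
      (use L in \<open>auto intro!: F_cell simp: field_simps\<close>)
  from has_integral_combine[OF _ _ Suc this] L show ?case
    by (simp add: divide_right_mono add_divide_distrib)
qed

text \<open>The sum of \<open>G n\<close> over the cells left of \<open>\<lambda> x\<close> is an increment of \<open>G (n + 1)\<close>. Since the
cells of level \<open>n\<close> to the left of \<open>\<lambda> x\<close> are as many as those of level \<open>n + 1\<close> to the left
of \<open>x\<close>, this increment is exactly \<open>F (n + 1) x - F (n + 1) 0\<close> up to the factor
\<open>R (n + 1) = \<delta>\<^sub>2 \<lambda>\<^sup>n R n\<close>. Only the incomplete last cell and the uniform distance from \<open>F n\<close> to
\<open>f\<close> contribute errors.\<close>
lemma limit_has_integral: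
  assumes f: "uniform_limit {0..} F f sequentially" and x: "0 \<le> x"
  shows "(f has_integral \<delta> * (f x - f 0)) {0..real lam * x}"
proof -
  have cont: "continuous_on {a..b} f" if "0 \<le> a" for a b
    using limit_continuous[OF f] by (rule continuous_on_subset) (use that in auto)
  define I where "I = integral {0..real lam * x} f"
  have I: "(f has_integral I) {0..real lam * x}"
    unfolding I_def by (intro integrable_integral integrable_continuous_real cont) simp
  obtain B where B: "\<And>n x. \<bar>F n x\<bar> \<le> B" using F_bounded by blast
  have fB: "\<bar>f y\<bar> \<le> B" if "0 \<le> y" for y
  proof (rule LIMSEQ_le_const2)
    show "(\<lambda>n. \<bar>F n y\<bar>) \<longlonglongrightarrow> \<bar>f y\<bar>"
      using that by (intro tendsto_rabs tendsto_uniform_limitI[OF f]) auto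
  qed (use B in auto)
  have B0: "0 \<le> B" using fB[of 0] by linarith
  have "(\<lambda>n. \<delta> * (F (Suc n) x - F (Suc n) 0)) \<longlonglongrightarrow> \<delta> * (f x - f 0)"
    using x by (intro tendsto_mult tendsto_const tendsto_diff LIMSEQ_Suc
        tendsto_uniform_limitI[OF f]) auto
  moreover have "(\<lambda>n. \<delta> * (F (Suc n) x - F (Suc n) 0)) \<longlonglongrightarrow> I"
  proof (rule LIMSEQ_I)
    fix e :: real assume e: "0 < e"
    define e' where "e' = e / 2 / (real lam * x + 1)"
    have den: "0 < real lam * x + 1" using x by (simp add: add_nonneg_pos)
    have e': "0 < e'" using e den by (simp add: e'_def)
    have "(\<lambda>n. B * (1 / real lam) ^ n) \<longlonglongrightarrow> B * 0"
      using lam2 by (intro tendsto_mult tendsto_const LIMSEQ_power_zero) auto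
    then have "\<forall>\<^sub>F n in sequentially. B * (1 / real lam) ^ n < e / 2"
      using e by (intro order_tendstoD(2)) auto
    moreover have "\<forall>\<^sub>F n in sequentially. \<forall>x\<in>{0..}. dist (F n x) (f x) < e'"
      using f e' by (auto simp: uniform_limit_iff)
    ultimately have "\<forall>\<^sub>F n in sequentially. norm (\<delta> * (F (Suc n) x - F (Suc n) 0) - I) < e"
    proof eventually_elim
      case (elim n)
      let ?L = "real lam ^ n"
      define M where "M = nat \<lfloor>?L * (real lam * x)\<rfloor>"
      \<comment> \<open>the last grid point to the left of \<open>\<lambda> x\<close>\<close>
      define y where "y = real M / ?L"
      have L: "0 < ?L" using lam_pos by simp
      have "0 \<le> ?L * (real lam * x)" using x by simp
      then have "real M \<le> ?L * (real lam * x)" "?L * (real lam * x) < real M + 1"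
        unfolding M_def by linarith+
      then have "y \<le> real lam * x" "real lam * x < (real M + 1) / ?L"
        using L by (simp_all only: y_def pos_divide_le_eq pos_less_divide_eq mult.commute)
      then have y: "0 \<le> y" "y \<le> real lam * x" "real lam * x - y \<le> 1 / ?L"
        using L by (auto simp: y_def add_divide_distrib)
      have FM: "F (Suc n) x = G (Suc n) M / R (Suc n)" "F (Suc n) 0 = G (Suc n) 0 / R (Suc n)"
        by (simp_all add: F_def M_def mult_ac)
      have "(F n has_integral (\<Sum>k<M. G n k) / (R n * ?L)) {0..y}"
        unfolding y_def by (rule F_has_integral)
      also have "(\<Sum>k<M. G n k) = G (Suc n) M - G (Suc n) 0"
        using G_Suc_add[of n 0 M] by simp
      also have "\<dots> / (R n * ?L) = \<delta> * (F (Suc n) x - F (Suc n) 0)"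
        using delta2 R_ne[of n] lam_pos by (simp add: FM R_Suc field_simps)
      finally have intF: "(F n has_integral \<delta> * (F (Suc n) x - F (Suc n) 0)) {0..y}" .
      have intf: "(f has_integral integral {0..y} f) {0..y}"
        by (intro integrable_integral integrable_continuous_real cont) simp
      have rest: "(f has_integral integral {y..real lam * x} f) {y..real lam * x}"
        by (intro integrable_integral integrable_continuous_real cont y)
      have "I = integral {0..y} f + integral {y..real lam * x} f"
        using has_integral_combine[OF y(1,2) intf rest] I by (metis has_integral_unique)
      moreover have "norm (integral {y..real lam * x} f) \<le> B * (real lam * x - y)"
        using has_integral_bound_real[OF B0 finite.emptyI rest] fB y
        by (auto simp: content_real)
      moreover have "B * (real lam * x - y) \<le> B * (1 / real lam) ^ n"
        using y(3) B0 by (intro mult_left_mono) (auto simp: power_divide)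
      moreover have "norm (\<delta> * (F (Suc n) x - F (Suc n) 0) - integral {0..y} f) \<le> e' * (y - 0)"
        using has_integral_bound_real[OF less_imp_le[OF e'] finite.emptyI
            has_integral_diff[OF intF intf]] elim(2) y(1)
        by (auto simp: content_real dist_real_def less_imp_le)
      moreover have "e' * (y - 0) \<le> e' * (real lam * x + 1)"
        using y e' by (intro mult_left_mono) auto
      moreover have "e' * (real lam * x + 1) = e / 2"
        unfolding e'_def by (rule nonzero_eq_divide_eq[THEN iffD1]) (use den in auto)
      ultimately show ?case using elim(1) unfolding real_norm_def by linarith
    qed
    then show "\<exists>no. \<forall>n\<ge>no. norm (\<delta> * (F (Suc n) x - F (Suc n) 0) - I) < e"
      by (simp add: eventually_sequentially)
  qed
  ultimately have "\<delta> * (f x - f 0) = I" by (rule LIMSEQ_unique)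
  with I show ?thesis by simp
qed

end

section \<open>The subshift as the closure of the orbit of the fixed point\<close>

lemma shift_funpow: "(shift ^^ k) u n = u (k + n)"
  by (induction k arbitrary: n) (auto simp: shift_def)

lemma shift_shift: "(shift ^^ k) ((shift ^^ l) u) = (shift ^^ (l + k)) u"
  by (simp add: fun_eq_iff shift_funpow add.assoc)

lemma compact_words: "compact (UNIV :: (nat \<Rightarrow> letter) set)"
proof -
  have "(UNIV :: letter set) \<subseteq> {La, Lb}" using letter.exhaust by blast
  then have "finite (UNIV :: letter set)" by (rule finite_subset) simp
  then have "compact (UNIV :: letter set)" by (rule finite_imp_compact)
  then have "compactin (product_topology (\<lambda>i :: nat. euclidean :: letter topology) UNIV)
      (PiE UNIV (\<lambda>i. UNIV))"
    unfolding compactin_PiE by simp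
  then show ?thesis by (simp add: euclidean_product_topology)
qed

text \<open>Convergence of infinite words is used in the form: longer and longer prefixes agree.\<close>
lemma tendsto_word:
  fixes x :: "nat \<Rightarrow> nat \<Rightarrow> letter"
  assumes "\<And>n i. i < n \<Longrightarrow> x n i = u i"
  shows "x \<longlonglongrightarrow> u"
proof -
  have "(\<lambda>n. x n i) \<longlonglongrightarrow> u i" for i
    by (rule tendsto_eventually) (auto simp: eventually_sequentially assms intro!: exI[of _ "Suc i"])
  then have "limitin (product_topology (\<lambda>i. euclidean) UNIV) x u sequentially"
    by (simp add: limitin_componentwise)
  then show ?thesis by (simp add: euclidean_product_topology)
qed

text \<open>Occurrence of both letters in both images is primitivity in one step. It makes the orbit of
\<open>w\<close> dense in the subshift, so that properties of continuous functions can be verified on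
the orbit.\<close>
locale primitive_fixed_point =
  fixes \<sigma> :: "letter \<Rightarrow> letter list" and lam :: nat and w :: "nat \<Rightarrow> letter"
  assumes length_image [simp]: "\<And>\<alpha>. length (\<sigma> \<alpha>) = lam" and lam2: "2 \<le> lam"
    and fixed_point: "subst_word \<sigma> w = w"
    and letters: "\<And>\<alpha> \<beta>. \<exists>r<lam. \<sigma> \<alpha> ! r = \<beta>"
begin

lemma length_subst_list [simp]: "length (subst_list \<sigma> v) = lam * length v"
  by (induction v) (auto simp: subst_list_def)

lemma subst_list_nth:
  "r < lam \<Longrightarrow> N < length v \<Longrightarrow> subst_list \<sigma> v ! (lam * N + r) = \<sigma> (v ! N) ! r"
proof (induction v arbitrary: N)
  case (Cons \<alpha> v)
  have "subst_list \<sigma> (\<alpha> # v) = \<sigma> \<alpha> @ subst_list \<sigma> v" by (simp add: subst_list_def)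
  then show ?case using Cons by (cases N) (auto simp: nth_append)
qed simp

text \<open>The prefix of \<open>u\<close> that is read to find the letter \<open>\<lambda> N + r\<close> includes \<open>u\<^sub>N\<close>, because \<open>\<lambda> \<ge> 1\<close>.\<close>
lemma subst_word_nth:
  assumes "r < lam"
  shows "subst_word \<sigma> u (lam * N + r) = \<sigma> (u N) ! r"
proof -
  have "N * 1 \<le> lam * N" using lam2 by (subst mult.commute) (intro mult_le_mono, auto)
  then have "N < Suc (lam * N + r)" by linarith
  then show ?thesis unfolding subst_word_def using assms
    by (subst subst_list_nth) (auto simp del: upt_Suc)
qed

lemma subst_word_div_mod: "subst_word \<sigma> u n = \<sigma> (u (n div lam)) ! (n mod lam)"
  using subst_word_nth[of "n mod lam" u "n div lam"] lam2 by simp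

lemma w_block: "r < lam \<Longrightarrow> w (lam * N + r) = \<sigma> (w N) ! r"
  using subst_word_nth[of r w N] fixed_point by simp

lemma subst_list_w: "subst_list \<sigma> (map w [a..<b]) = map w [lam * a..<lam * b]"
proof (rule nth_equalityI)
  fix i assume "i < length (subst_list \<sigma> (map w [a..<b]))"
  then have i: "i < lam * (b - a)" by simp
  define q r where "q = i div lam" and "r = i mod lam"
  have r: "r < lam" and iqr: "i = lam * q + r" using lam2 by (auto simp: q_def r_def)
  have q: "q < b - a" using i lam2 by (simp add: q_def less_mult_imp_div_less mult.commute)
  have "subst_list \<sigma> (map w [a..<b]) ! i = w (lam * (a + q) + r)"
    unfolding iqr using r q by (subst subst_list_nth) (auto simp: w_block)
  also have "lam * (a + q) + r = lam * a + i" by (simp add: iqr algebra_simps)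
  also have "w (lam * a + i) = map w [lam * a..<lam * b] ! i"
    using i by (simp add: right_diff_distrib')
  finally show "subst_list \<sigma> (map w [a..<b]) ! i = map w [lam * a..<lam * b] ! i" .
qed (simp add: right_diff_distrib')

lemma subst_list_power_w:
  "(subst_list \<sigma> ^^ n) (map w [a..<b]) = map w [lam ^ n * a..<lam ^ n * b]"
  by (induction n) (auto simp: subst_list_w mult.assoc)

lemma letter_occurs: "\<exists>k. w k = \<beta>"
  using letters[of "w 0" \<beta>] w_block[of _ 0] by auto

lemma factor_in_language: "map w [a..<b] \<in> language \<sigma>"
proof -
  have "a \<le> b \<Longrightarrow> sublist (map w [a..<b]) ((subst_list \<sigma> ^^ b) [w 0])"
  proof -
    assume ab: "a \<le> b"
    have "b < 2 ^ b" by (rule less_exp)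
    also have "(2 :: nat) ^ b \<le> lam ^ b" using lam2 by (rule power_mono) simp
    finally have "b \<le> lam ^ b" by simp
    with ab have "[0..<lam ^ b] = [0..<a] @ [a..<b] @ [b..<lam ^ b]"
      using upt_add_eq_append[of 0 b "lam ^ b - b"] upt_add_eq_append[of 0 a "b - a"] by simp
    moreover have "(subst_list \<sigma> ^^ b) [w 0] = map w [0..<lam ^ b]"
      using subst_list_power_w[of b 0 1] by simp
    ultimately show ?thesis unfolding sublist_def by (metis map_append)
  qed
  moreover have "b < a \<Longrightarrow> sublist (map w [a..<b]) ((subst_list \<sigma> ^^ b) [w 0])" by simp
  ultimately show ?thesis unfolding language_def by (metis (mono_tags, lifting) leI mem_Collect_eq)
qed

lemma language_occurs:
  assumes "v \<in> language \<sigma>"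
  shows "\<exists>k. \<forall>i<length v. v ! i = w (k + i)"
proof -
  obtain n \<alpha> where "sublist v ((subst_list \<sigma> ^^ n) [\<alpha>])"
    using assms by (auto simp: language_def)
  moreover obtain k where "w k = \<alpha>" using letter_occurs by blast
  ultimately have "sublist v (map w [lam ^ n * k..<lam ^ n * Suc k])"
    using subst_list_power_w[of n k "Suc k"] by simp
  then obtain ps ss where e: "map w [lam ^ n * k..<lam ^ n * Suc k] = ps @ v @ ss"
    by (auto simp: sublist_def)
  have "v ! i = w (lam ^ n * k + length ps + i)" if "i < length v" for i
  proof -
    have "v ! i = map w [lam ^ n * k..<lam ^ n * Suc k] ! (length ps + i)"
      unfolding e using that by (simp add: nth_append)
    moreover have "length ps + i < lam ^ n"
      using arg_cong[OF e, of length] that by simp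
    ultimately show ?thesis by (simp add: add.assoc)
  qed
  then show ?thesis by blast
qed

text \<open>The subshift is the closure of the orbit of \<open>w\<close>. A word of the language is a factor of some
\<open>\<sigma>\<^sup>n(\<alpha>)\<close>, and \<open>\<alpha>\<close> occurs in \<open>w = \<sigma>\<^sup>n(w)\<close>; conversely a factor of \<open>w\<close> is contained in a prefix
\<open>\<sigma>\<^sup>n(w\<^sub>0)\<close>.\<close>
lemma subshift_iff: "u \<in> subshift \<sigma> \<longleftrightarrow> (\<forall>n. \<exists>k. \<forall>i<n. u i = w (k + i))"
proof
  assume u: "u \<in> subshift \<sigma>"
  show "\<forall>n. \<exists>k. \<forall>i<n. u i = w (k + i)"
  proof
    fix n
    have "map u [0..<n] \<in> language \<sigma>" using u by (simp add: subshift_def)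
    from language_occurs[OF this] show "\<exists>k. \<forall>i<n. u i = w (k + i)" by auto
  qed
next
  assume dense: "\<forall>n. \<exists>k. \<forall>i<n. u i = w (k + i)"
  have "map u [i..<j] \<in> language \<sigma>" for i j
  proof -
    obtain k where "\<And>i. i < j \<Longrightarrow> u i = w (k + i)" using dense by blast
    then have "map u [i..<j] = map w [k + i..<k + j]" by (intro nth_equalityI) (auto simp: add.assoc)
    then show ?thesis using factor_in_language by simp
  qed
  then show "u \<in> subshift \<sigma>" by (simp add: subshift_def)
qed

lemma orbit_in_subshift: "(shift ^^ k) w \<in> subshift \<sigma>"
  unfolding subshift_iff by (intro allI exI[of _ k]) (simp add: shift_funpow)

text \<open>A word outside the subshift has a prefix that does not occur in \<open>w\<close>, and all words with
that prefix are outside as well. So the subshift is closed in a compact space.\<close>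
lemma compact_subshift: "compact (subshift \<sigma>)"
proof -
  have "open (- subshift \<sigma>)"
  proof (subst open_subopen, intro ballI)
    fix u assume "u \<in> - subshift \<sigma>"
    then obtain n where n: "\<And>k. \<exists>i<n. u i \<noteq> w (k + i)" by (auto simp: subshift_iff)
    define U where "U = {v. \<forall>i\<in>{..<n}. v i \<in> {u i}}"
    have "open U" unfolding U_def
      by (rule product_topology_basis') (auto simp: open_letter_def)
    moreover have "u \<in> U" by (simp add: U_def)
    moreover have "U \<subseteq> - subshift \<sigma>"
    proof
      fix v assume "v \<in> U"
      then have "\<And>i. i < n \<Longrightarrow> v i = u i" by (simp add: U_def)
      with n show "v \<in> - subshift \<sigma>" unfolding Compl_iff subshift_iff by metis
    qed
    ultimately show "\<exists>T. open T \<and> u \<in> T \<and> T \<subseteq> - subshift \<sigma>" by blast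
  qed
  then have "closed (subshift \<sigma>)" by (simp add: closed_def)
  then show ?thesis using compact_Int_closed[OF compact_words] by force
qed

lemma orbit_bounded:
  assumes "continuous_on (subshift \<sigma>) f"
  shows "\<exists>B :: real. \<forall>N. \<bar>f ((shift ^^ N) w)\<bar> \<le> B"
proof -
  have "bounded (f ` subshift \<sigma>)"
    using assms compact_subshift by (intro compact_imp_bounded compact_continuous_image)
  then show ?thesis using orbit_in_subshift by (auto simp: bounded_iff)
qed

lemma subst_word_power_shift:
  "(subst_word \<sigma> ^^ i) ((shift ^^ k) u) = (shift ^^ (lam ^ i * k)) ((subst_word \<sigma> ^^ i) u)"
proof (induction i)
  case (Suc i)
  have "subst_word \<sigma> ((shift ^^ l) v) = (shift ^^ (lam * l)) (subst_word \<sigma> v)" for l v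
    using lam2 by (simp add: fun_eq_iff shift_funpow subst_word_div_mod)
  with Suc show ?case by (simp add: mult.assoc)
qed simp

lemma subst_word_power_w [simp]: "(subst_word \<sigma> ^^ i) w = w"
  by (induction i) (auto simp: fixed_point)

lemma subst_word_power_cong:
  assumes "\<And>j. j < n \<Longrightarrow> u j = v j"
  shows "j < n \<Longrightarrow> (subst_word \<sigma> ^^ i) u j = (subst_word \<sigma> ^^ i) v j"
proof (induction i arbitrary: j)
  case (Suc i)
  have "j div lam < n" using Suc.prems by (meson div_le_dividend le_less_trans)
  then show ?case
    using Suc.IH by (simp add: subst_word_div_mod[of "(subst_word \<sigma> ^^ i) u"]
        subst_word_div_mod[of "(subst_word \<sigma> ^^ i) v"])
qed (simp add: assms)

text \<open>A word \<open>u\<close> that starts with \<open>\<alpha>\<close> is a limit of shifts \<open>T\<^sup>k w\<close> with \<open>w\<^sub>k = \<alpha>\<close>. Since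
\<open>\<sigma>\<close> only lengthens common prefixes, \<open>T\<^sup>m \<sigma>\<^sup>i(u)\<close> is the limit of the words
\<open>T\<^sup>m \<sigma>\<^sup>i(T\<^sup>k w)\<close>, which are shifts of \<open>w\<close> by \<open>\<lambda>\<^sup>i k + m\<close>.\<close>
lemma constant_on_block:
  assumes cont: "continuous_on (subshift \<sigma>) f"
    and const: "\<And>k. w k = \<alpha> \<Longrightarrow> f ((shift ^^ (lam ^ i * k + m)) w) = (c :: real)"
  shows "f ` (shift ^^ m) ` (subst_word \<sigma> ^^ i) ` cylinder \<sigma> \<alpha> = {c}"
proof -
  have "f ((shift ^^ m) ((subst_word \<sigma> ^^ i) u)) = c" if u: "u \<in> cylinder \<sigma> \<alpha>" for u
  proof -
    have "\<forall>n. \<exists>k. \<forall>i<n. u i = w (k + i)" using u by (simp add: cylinder_def subshift_iff)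
    then obtain k where k: "\<And>n i. i < n \<Longrightarrow> u i = w (k n + i)" by metis
    \<comment> \<open>agreement on \<open>n + m\<close> letters leaves \<open>n\<close> after the shift by \<open>m\<close>; one more keeps the first letter\<close>
    define x where "x n = (shift ^^ (lam ^ i * k (Suc (n + m)) + m)) w" for n
    let ?y = "(shift ^^ m) ((subst_word \<sigma> ^^ i) u)"
    have agree: "x n j = ?y j" if "j < n" for n j
    proof -
      have "x n = (shift ^^ m) ((subst_word \<sigma> ^^ i) ((shift ^^ k (Suc (n + m))) w))"
        by (simp add: x_def subst_word_power_shift shift_shift)
      then have "x n j = (subst_word \<sigma> ^^ i) ((shift ^^ k (Suc (n + m))) w) (m + j)"
        by (simp add: shift_funpow)
      also have "\<dots> = (subst_word \<sigma> ^^ i) u (m + j)"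
        by (rule subst_word_power_cong[where n = "Suc (n + m)"]) (use k that in \<open>auto simp: shift_funpow\<close>)
      finally show ?thesis by (simp add: shift_funpow)
    qed
    have "?y \<in> subshift \<sigma>"
      unfolding subshift_iff
    proof
      fix n
      have "\<And>j. j < n \<Longrightarrow> ?y j = w (lam ^ i * k (Suc (n + m)) + m + j)"
        using agree[of _ n] by (simp add: x_def shift_funpow)
      then show "\<exists>k. \<forall>i<n. ?y i = w (k + i)" by blast
    qed
    then have "(\<lambda>n. f (x n)) \<longlonglongrightarrow> f ?y"
      using agree by (intro continuous_on_tendsto_compose[OF cont] tendsto_word)
        (auto simp: x_def orbit_in_subshift)
    moreover have "f (x n) = c" for n
    proof -
      have "w (k (Suc (n + m))) = u 0" using k[of 0 "Suc (n + m)"] by simp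
      then show ?thesis using u by (simp add: x_def const cylinder_def)
    qed
    ultimately show ?thesis by (simp add: LIMSEQ_const_iff)
  qed
  moreover obtain k where "w k = \<alpha>" using letter_occurs by blast
  then have "(shift ^^ k) w \<in> cylinder \<sigma> \<alpha>"
    using orbit_in_subshift by (simp add: cylinder_def shift_funpow)
  ultimately show ?thesis by (auto simp: image_image)
qed

end

section \<open>Convergence of the renormalized functions\<close>

lemma uniform_limit_Suc_iff:
  "uniform_limit A (\<lambda>n. f (Suc n)) l sequentially \<longleftrightarrow> uniform_limit A f l sequentially"
proof -
  have "(\<forall>\<^sub>F n in sequentially. \<forall>x\<in>A. dist (f (Suc n) x) (l x) < e)
      \<longleftrightarrow> (\<forall>\<^sub>F n in sequentially. \<forall>x\<in>A. dist (f n x) (l x) < e)" for e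
    by (rule eventually_sequentially_Suc)
  then show ?thesis by (simp add: uniform_limit_iff)
qed

theorem mainTheorem5:
  fixes \<sigma> :: "letter \<Rightarrow> letter list" and lam :: nat and w :: "nat \<Rightarrow> letter"
    and \<phi> :: "letter \<Rightarrow> real" and \<mu> :: "(nat \<Rightarrow> letter) measure"
    and \<psi>\<^sub>0 :: real and \<psi> :: "nat \<Rightarrow> (nat \<Rightarrow> letter) \<Rightarrow> real"
  assumes uniform: "uniform_subst lam \<sigma>"
    and nonconst: "\<phi> La \<noteq> \<phi> Lb"
    and delta1: "delta \<sigma> \<phi> 1 = 0"
    and delta2: "delta \<sigma> \<phi> 2 \<noteq> 0"
    and fixed_point: "subst_word \<sigma> w = w"
    and mu: "invariant_prob \<sigma> \<mu>"
    and psi: "psi_sequence \<sigma> \<phi> \<mu> \<psi>\<^sub>0 \<psi>"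
  shows "\<exists>f_w f_a f_b :: real \<Rightarrow> real.
      uniform_limit {0..} (step_word \<sigma> lam \<phi> \<psi> w) f_w sequentially \<and>
      uniform_limit {0..real lam} (step_letter \<sigma> lam \<phi> \<psi> La) f_a sequentially \<and>
      uniform_limit {0..real lam} (step_letter \<sigma> lam \<phi> \<psi> Lb) f_b sequentially \<and>
      continuous_on {0..} f_w \<and>
      continuous_on {0..real lam} f_a \<and>
      continuous_on {0..real lam} f_b \<and>
      (\<exists>x\<in>{0..real lam}. f_a x \<noteq> 0) \<and> (\<exists>x\<in>{0..real lam}. f_b x \<noteq> 0) \<and>
      f_a 0 = f_b 0 \<and>
      (\<lambda>i. - const_c \<psi> w i / renorm \<sigma> lam \<phi> i) \<longlonglongrightarrow> f_a 0 \<and>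
      (\<forall>x\<in>{0..real lam}. \<forall>n. f_w (x + real lam * real n) = (case w n of La \<Rightarrow> f_a x | Lb \<Rightarrow> f_b x)) \<and>
      (\<forall>x\<ge>0. (f_w has_integral delta \<sigma> \<phi> 2 * (f_w x - f_w 0)) {0..real lam * x})"
proof -
  define p where "p \<alpha> = \<phi> \<alpha> + \<psi>\<^sub>0" for \<alpha>
  define G where "G n N = \<psi> (Suc n) ((shift ^^ N) w)" for n N
  have delta_p: "delta \<sigma> p i = delta \<sigma> \<phi> i" for i
    unfolding p_def[abs_def] by (rule delta_add_const[OF uniform])
  have p_ne: "p La \<noteq> p Lb" using nonconst by (simp add: p_def)
  have lam2: "2 \<le> lam" by (rule two_le_length[OF uniform delta2])
  interpret orbit: primitive_fixed_point \<sigma> lam w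
  proof
    show "length (\<sigma> \<alpha>) = lam" for \<alpha>
      using uniform by (cases \<alpha>) (auto simp: uniform_subst_def)
  qed (rule lam2 fixed_point both_letters[OF uniform nonconst delta1 delta2])+
  have psi_cont: "continuous_on (subshift \<sigma>) (\<psi> (Suc n))" for n
  proof -
    have "\<forall>i\<ge>1. continuous_on (subshift \<sigma>) (\<psi> i)"
      using psi unfolding psi_sequence_def by blast
    then show ?thesis by simp
  qed
  interpret tower: primitive_tower \<sigma> lam w p G
  proof
    fix n N
    have "\<phi> (((shift ^^ N) w) 0) + \<psi>\<^sub>0 = \<psi> 1 (shift ((shift ^^ N) w)) - \<psi> 1 ((shift ^^ N) w)"
      using psi orbit.orbit_in_subshift unfolding psi_sequence_def by blast
    then show "G 0 (Suc N) = G 0 N + p (w N)" by (simp add: G_def p_def shift_funpow)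
    have "1 \<le> Suc n \<longrightarrow> \<psi> (Suc n) ((shift ^^ N) w)
        = \<psi> (Suc (Suc n)) (shift ((shift ^^ N) w)) - \<psi> (Suc (Suc n)) ((shift ^^ N) w)"
      using psi orbit.orbit_in_subshift unfolding psi_sequence_def by blast
    then show "G (Suc n) (Suc N) = G (Suc n) N + G n N" by (simp add: G_def)
    show "\<exists>B. \<forall>N. \<bar>G n N\<bar> \<le> B"
      unfolding G_def by (rule orbit.orbit_bounded[OF psi_cont])
  qed (simp_all add: uniform lam2 p_ne delta1[unfolded One_nat_def] delta2 delta_p orbit.w_block)
  have renorm: "renorm \<sigma> lam \<phi> (Suc n) = tower.R n" for n
    by (simp add: renorm_def tower.R_def delta_p)
  have word: "step_word \<sigma> lam \<phi> \<psi> w (Suc n) = tower.F n" for n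
    by (simp add: fun_eq_iff step_word_def tower.F_def renorm G_def)
  \<comment> \<open>at every level the letter functions are translated restrictions of the word function\<close>
  have letter: "step_letter \<sigma> lam \<phi> \<psi> (w N) (Suc n) x = tower.F n (x + real lam * real N)"
    if x: "0 \<le> x" "x \<le> real lam" for n N x
  proof -
    define m where "m = nat \<lfloor>real lam ^ n * x\<rfloor>"
    \<comment> \<open>the end point \<open>x = \<lambda>\<close> belongs to the next block, whose starting value is the same\<close>
    define m' where "m' = (if m = lam ^ Suc n then 0 else m)"
    have "real lam ^ n * x \<le> real lam ^ n * real lam" using x by (intro mult_left_mono) auto
    then have "\<lfloor>real lam ^ n * x\<rfloor> \<le> \<lfloor>real (lam ^ Suc n)\<rfloor>"
      by (intro floor_mono) (simp add: mult.commute)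
    then have m: "m \<le> lam ^ Suc n" unfolding m_def by (simp only: floor_of_nat nat_le_iff)
    then have m': "m' < lam ^ Suc n" using lam2 by (auto simp: m'_def)
    have "\<psi> (Suc n) ((shift ^^ (lam ^ Suc n * k + m')) w) = G n (lam ^ Suc n * N + m')"
      if "w k = w N" for k
      using tower.G_determined[OF that m' lessI] by (simp add: G_def)
    then have "\<psi> (Suc n) ` (shift ^^ m') ` (subst_word \<sigma> ^^ Suc n) ` cylinder \<sigma> (w N)
        = {G n (lam ^ Suc n * N + m')}"
      by (rule orbit.constant_on_block[OF psi_cont])
    then have "block_value \<sigma> lam \<psi> (Suc n) m (w N) = G n (lam ^ Suc n * N + m')"
      unfolding block_value_def m'_def by (simp only: the_elem_eq)
    also have "\<dots> = G n (lam ^ Suc n * N + m)"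
    proof (cases "m = lam ^ Suc n")
      case True
      then have "lam ^ Suc n * N + m = lam ^ Suc n * Suc N" "m' = 0" by (simp_all add: m'_def)
      then show ?thesis by (simp only: add_0_right tower.G_block_start[OF lessI])
    qed (simp add: m'_def)
    also have "lam ^ Suc n * N + m = nat \<lfloor>real lam ^ n * (x + real lam * real N)\<rfloor>"
    proof -
      have "real lam ^ n * (x + real lam * real N) = real lam ^ n * x + of_int (int (lam ^ Suc n * N))"
        by (simp add: algebra_simps)
      then have "\<lfloor>real lam ^ n * (x + real lam * real N)\<rfloor>
          = \<lfloor>real lam ^ n * x\<rfloor> + int (lam ^ Suc n * N)"
        by (simp only: floor_add_int[symmetric])
      moreover have "0 \<le> \<lfloor>real lam ^ n * x\<rfloor>" using x by simp
      ultimately show ?thesis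
        by (simp only: m_def nat_add_distrib of_nat_0_le_iff nat_int add.commute)
    qed
    finally show ?thesis by (simp add: step_letter_def tower.F_def renorm m_def)
  qed
  obtain f where f: "uniform_limit {0..} tower.F f sequentially"
    using tower.F_uniform_limit by blast
  have letter_limit: "uniform_limit {0..real lam} (step_letter \<sigma> lam \<phi> \<psi> (w N))
      (\<lambda>x. f (x + real lam * real N)) sequentially" for N
  proof (subst uniform_limit_Suc_iff[symmetric], rule uniform_limitI)
    fix e :: real assume "0 < e"
    with f have "\<forall>\<^sub>F n in sequentially. \<forall>x\<in>{0..}. dist (tower.F n x) (f x) < e"
      by (auto simp: uniform_limit_iff)
    then show "\<forall>\<^sub>F n in sequentially. \<forall>x\<in>{0..real lam}.
        dist (step_letter \<sigma> lam \<phi> \<psi> (w N) (Suc n) x) (f (x + real lam * real N)) < e"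
      by eventually_elim (simp add: letter)
  qed
  have same: "f (x + real lam * real N) = f (x + real lam * real N')"
    if "w N = w N'" "x \<in> {0..real lam}" for x N N'
    using tendsto_uniform_limitI[OF letter_limit[of N] that(2)]
      tendsto_uniform_limitI[OF letter_limit[of N'] that(2)] that(1)
    by (auto intro: LIMSEQ_unique)
  have start: "f (real lam * real N) = f 0" for N
  proof -
    have "tower.F n (real lam * real N) = tower.F n 0" for n
    proof -
      have "nat \<lfloor>real lam ^ n * (real lam * real N)\<rfloor> = nat \<lfloor>real (lam ^ Suc n * N)\<rfloor>"
        by (simp add: mult_ac)
      also have "\<dots> = lam ^ Suc n * N" by (simp only: floor_of_nat nat_int)
      finally show ?thesis by (simp only: tower.F_def tower.G_block_start[OF lessI]) simp
    qed
    then show ?thesis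
      using tendsto_uniform_limitI[OF f, of "real lam * real N"] tendsto_uniform_limitI[OF f, of 0]
      by (auto intro: LIMSEQ_unique)
  qed
  obtain na nb where na: "w na = La" and nb: "w nb = Lb"
    using orbit.letter_occurs by metis
  define f_a f_b where "f_a x = f (x + real lam * real na)" and "f_b x = f (x + real lam * real nb)" for x
  have cont: "continuous_on {0..real lam} (\<lambda>x. f (x + real lam * real N))" for N
    by (rule continuous_on_compose2[OF tower.limit_continuous[OF f]]) (auto intro!: continuous_intros)
  show ?thesis
  proof (rule exI[of _ f], rule exI[of _ f_a], rule exI[of _ f_b], intro conjI ballI allI impI)
    show "uniform_limit {0..} (step_word \<sigma> lam \<phi> \<psi> w) f sequentially"
      using f by (subst uniform_limit_Suc_iff[symmetric]) (simp add: word)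
    show "uniform_limit {0..real lam} (step_letter \<sigma> lam \<phi> \<psi> La) f_a sequentially"
      using letter_limit[of na] by (simp add: f_a_def[abs_def] na)
    show "uniform_limit {0..real lam} (step_letter \<sigma> lam \<phi> \<psi> Lb) f_b sequentially"
      using letter_limit[of nb] by (simp add: f_b_def[abs_def] nb)
    show "continuous_on {0..} f" by (rule tower.limit_continuous[OF f])
    show "continuous_on {0..real lam} f_a" "continuous_on {0..real lam} f_b"
      unfolding f_a_def[abs_def] f_b_def[abs_def] by (rule cont)+
    show "\<exists>x\<in>{0..real lam}. f_a x \<noteq> 0" "\<exists>x\<in>{0..real lam}. f_b x \<noteq> 0"
      unfolding f_a_def f_b_def by (rule tower.limit_nonzero_on_block[OF f])+
    show "f_a 0 = f_b 0" by (simp add: f_a_def f_b_def start)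
    have "(\<lambda>n. tower.F n 0) \<longlonglongrightarrow> f_a 0"
      using tendsto_uniform_limitI[OF f, of 0] by (simp add: f_a_def start)
    moreover have "tower.F n 0 = - const_c \<psi> w (Suc n) / renorm \<sigma> lam \<phi> (Suc n)" for n
      by (simp add: tower.F_def const_c_def renorm G_def)
    ultimately have "(\<lambda>n. - const_c \<psi> w (Suc n) / renorm \<sigma> lam \<phi> (Suc n)) \<longlonglongrightarrow> f_a 0" by simp
    then show "(\<lambda>i. - const_c \<psi> w i / renorm \<sigma> lam \<phi> i) \<longlonglongrightarrow> f_a 0"
      by (rule LIMSEQ_imp_Suc)
  next
    fix x n assume "x \<in> {0..real lam}"
    then show "f (x + real lam * real n) = (case w n of La \<Rightarrow> f_a x | Lb \<Rightarrow> f_b x)"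
      using same[of n na x] same[of n nb x] na nb by (auto simp: f_a_def f_b_def split: letter.split)
  next
    fix x :: real assume "0 \<le> x"
    then show "(f has_integral delta \<sigma> \<phi> 2 * (f x - f 0)) {0..real lam * x}"
      using tower.limit_has_integral[OF f, of x] by (simp add: delta_p)
  qed
qed

end
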